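(* Let $N\geq 2$ be an integer and set $\gamma_N:=\dfrac{4\pi^N N}{(N-1)!}$. Then $$\kappa':=\sup_{u\in\mathcal{H}_{rad}(\mathbb{R}^{2N}),\ \|u\|_{\mathcal{H}(\mathbb{R}^{2N})}\leq 1}\int_{\mathbb{R}^{2N}}\Big(e^{\gamma_N|u(x)|^2}-1\Big)\,dx$$ is a finite positive constant, and for every $\gamma>\gamma_N$, $$\sup_{u\in\mathcal{H}_{rad}(\mathbb{R}^{2N}),\ \|u\|_{\mathcal{H}(\mathbb{R}^{2N})}\leq 1}\int_{\mathbb{R}^{2N}}\Big(e^{\gamma|u(x)|^2}-1\Big)\,dx=+\infty.$$
   Context: For an integer $N\geq 2$, $\mathcal{H}(\mathbb{R}^{2N}):=\{u\in H^1(\mathbb{R}^{2N}):\ \nabla u/|x|^{N-1}\in L^2(\mathbb{R}^{2N})\}$, endowed with the norm $\|u\|_{\mathcal{H}(\mathbb{R}^{2N})}^2=\|u\|_{H^1(\mathbb{R}^{2N})}^2+\big\|\nabla u/|x|^{N-1}\big\|_{L^2(\mathbb{R}^{2N})}^2$, where $\|u\|_{H^1}^2=\|u\|_{L^2}^2+\|\nabla u\|_{L^2}^2$. $\mathcal{H}_{rad}(\mathbb{R}^{2N})$ denotes the subspace of radial functions in $\mathcal{H}(\mathbb{R}^{2N})$. *)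

theory Defs
  imports "HOL-Analysis.Analysis"
begin

definition partial :: "(real^'n \<Rightarrow> real) \<Rightarrow> 'n \<Rightarrow> real^'n \<Rightarrow> real" where
  "partial f i x = frechet_derivative f (at x) (axis i 1)"

fun Ck :: "nat \<Rightarrow> (real^'n \<Rightarrow> real) \<Rightarrow> bool" where
  "Ck 0 f = continuous_on UNIV f"
| "Ck (Suc k) f = ((\<forall>x. f differentiable (at x)) \<and> (\<forall>i. Ck k (partial f i)))"

definition test_fun :: "(real^'n \<Rightarrow> real) \<Rightarrow> bool" where
  "test_fun \<phi> \<longleftrightarrow> (\<forall>k. Ck k \<phi>) \<and> compact (closure {x. \<phi> x \<noteq> 0})"

text \<open>g is a weak gradient of u (u, g locally integrable via the standing assumptions).\<close>
definition weak_grad :: "(real^'n \<Rightarrow> real) \<Rightarrow> (real^'n \<Rightarrow> real^'n) \<Rightarrow> bool" where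
  "weak_grad u g \<longleftrightarrow> (\<forall>\<phi>. test_fun \<phi> \<longrightarrow> (\<forall>i.
      (\<integral>x. u x * partial \<phi> i x \<partial>lebesgue) = - (\<integral>x. g x $ i * \<phi> x \<partial>lebesgue)))"

definition radial :: "(real^'n \<Rightarrow> real) \<Rightarrow> bool" where
  "radial u \<longleftrightarrow> (\<forall>x y. norm x = norm y \<longrightarrow> u x = u y)"

text \<open>Closed unit ball of H_rad(R^{2N}) (here R^{2N} = real^'n with CARD('n) = 2N):
  u in H^1, weak gradient g with |g|/|x|^(N-1) in L^2, and
  ||u||_2^2 + ||g||_2^2 + || g/|x|^(N-1) ||_2^2 <= 1.\<close>
definition Hrad_ball :: "nat \<Rightarrow> (real^'n \<Rightarrow> real) set" where
  "Hrad_ball N = {u. radial u \<and> u \<in> borel_measurable lebesgue \<and>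
     (\<exists>g. g \<in> borel_measurable lebesgue \<and> weak_grad u g \<and>
        integrable lebesgue (\<lambda>x. (u x)\<^sup>2) \<and>
        integrable lebesgue (\<lambda>x. (norm (g x))\<^sup>2) \<and>
        integrable lebesgue (\<lambda>x. (norm (g x) / norm x ^ (N - 1))\<^sup>2) \<and>
        (\<integral>x. (u x)\<^sup>2 \<partial>lebesgue) + (\<integral>x. (norm (g x))\<^sup>2 \<partial>lebesgue)
          + (\<integral>x. (norm (g x) / norm x ^ (N - 1))\<^sup>2 \<partial>lebesgue) \<le> 1)}"

definition gammaN :: "nat \<Rightarrow> real" where
  "gammaN N = 4 * pi ^ N * real N / fact (N - 1)"

definition MT_sup :: "nat \<Rightarrow> real \<Rightarrow> ('n::finite) itself \<Rightarrow> ennreal" where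
  "MT_sup N \<gamma> _ = (SUP u\<in>(Hrad_ball N :: (real^'n \<Rightarrow> real) set).
      \<integral>\<^sup>+ x. ennreal (exp (\<gamma> * (u x)\<^sup>2) - 1) \<partial>lebesgue)"

end

theory Submission
  imports Defs
begin

text \<open>
  In the volume variable \<open>t = \<bar>x\<bar>\<^sup>2\<^sup>N\<close> a radial \<open>u(x) = v(t)\<close> has weighted Dirichlet energy
  \<open>\<gamma>\<^sub>N \<integral> \<bar>v'(t)\<bar>\<^sup>2 t dt\<close>, the radial energy in the plane, so the problem becomes the planar
  Trudinger-Moser problem. All that is needed of the weak gradient is the oscillation estimate
  \<open>\<gamma>\<^sub>N (v(b) - v(a))\<^sup>2 \<le> E(a,b) ln (b/a)\<close> for almost all \<open>a < b\<close>, where \<open>E(a,b)\<close> is the weighted energy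
  in the shell \<open>a < t \<le> b\<close>; it comes from testing with \<open>x\<^sub>i \<Psi>(t)/t\<close>, the divergence of the field
  \<open>x \<Psi>(t)/t\<close> being \<open>2N \<Psi>'(t)\<close>, for smoothed trapezoids \<open>\<Psi>\<close>. Moser's level set argument bounds the
  exponential integral near the origin. As in Ruf's treatment of the full norm, the value of \<open>v\<close> at a
  suitable cut is paid for by \<open>D = \<parallel>u\<parallel>\<^sup>2\<close>, since \<open>(1 + D)(1 - D) \<le> 1\<close>; beyond the cut \<open>v\<close> is bounded.
  Sharpness is seen on truncated logarithms.
\<close>

subsection \<open>Smooth functions of one variable\<close>

text \<open>The gradient is accessible only through integrals against smooth compactly supported
  functions, so the trapezoids must be genuinely smooth, and the estimates hold at almost all radii
  rather than all of them. The field \<open>x\<close> \<Psi>(t)/t turns |g . x| into the product of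
  |g|/|x|^(N-1) and |x|^(-N); the square of the latter has integral \<beta> ln(b/a) over the shell,
  with \<beta> the volume of the unit ball. Squaring the factor 2N of the divergence and cancelling
  one \<beta> leaves 4 N^2 \<beta>, which is \<gamma>_N. At this exponent the oscillation estimate
  alone gives exp(f^2) <= T/t, which just fails to be integrable at 0; hence the slicing by the
  deficit ln(T/t) - f^2. A cut \<tau> brings a second loss. For the scaled profile w and x = w(t) -
  w(\<tau>), Young's inequality gives w(t)^2 <= (1+D) x^2 + (1+1/D) w(\<tau>)^2. The factor 1+D is
  exactly what an energy of at most 1-D tolerates, and averaging the L2 norm finds \<tau> with
  w(\<tau>)^2 <= D, so that the last term is at most 2.\<close>

fun Dk :: "nat \<Rightarrow> (real \<Rightarrow> real) \<Rightarrow> bool" where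
  "Dk 0 f = continuous_on UNIV f"
| "Dk (Suc k) f = (\<exists>f'. (\<forall>x. (f has_real_derivative f' x) (at x)) \<and> Dk k f')"

lemma Dk_SucD: "Dk (Suc k) f \<Longrightarrow> Dk k f"
  by (induction k arbitrary: f) (auto intro: DERIV_continuous_on)

lemma Dk_const: "Dk k (\<lambda>x. c)"
proof (induction k arbitrary: c)
  case (Suc k)
  then show ?case by (auto intro!: exI[of _ "\<lambda>x. 0"])
qed auto

lemma Dk_affine: "Dk k (\<lambda>x. a * x + b)"
  by (cases k) (auto intro!: continuous_intros exI[of _ "\<lambda>x. a"] derivative_eq_intros Dk_const)

lemma Dk_add: "Dk k f \<Longrightarrow> Dk k g \<Longrightarrow> Dk k (\<lambda>x. f x + g x)"
proof (induction k arbitrary: f g)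
  case 0
  then show ?case by (auto intro!: continuous_intros)
next
  case (Suc k)
  then obtain f' g' where *: "\<And>x. (f has_real_derivative f' x) (at x)" "Dk k f'"
    "\<And>x. (g has_real_derivative g' x) (at x)" "Dk k g'" by auto
  show ?case
    unfolding Dk.simps
    by (rule exI[of _ "\<lambda>x. f' x + g' x"]) (auto intro!: Suc.IH DERIV_add *)
qed

lemma Dk_mult: "Dk k f \<Longrightarrow> Dk k g \<Longrightarrow> Dk k (\<lambda>x. f x * g x)"
proof (induction k arbitrary: f g)
  case 0
  then show ?case by (auto intro!: continuous_intros)
next
  case (Suc k)
  then obtain f' g' where *: "\<And>x. (f has_real_derivative f' x) (at x)" "Dk k f'"
    "\<And>x. (g has_real_derivative g' x) (at x)" "Dk k g'" by auto
  show ?case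
    unfolding Dk.simps
    by (rule exI[of _ "\<lambda>x. f' x * g x + g' x * f x"])
       (use Suc.prems[THEN Dk_SucD] in \<open>auto intro!: Suc.IH Dk_add DERIV_mult * simp del: Dk.simps\<close>)
qed

lemma Dk_cmult: "Dk k f \<Longrightarrow> Dk k (\<lambda>x. c * f x)"
  by (rule Dk_mult[OF Dk_const])

lemma Dk_compose_affine: "Dk k f \<Longrightarrow> Dk k (\<lambda>x. f (a * x + b))"
proof (induction k arbitrary: f)
  case 0
  then show ?case by (auto intro!: continuous_on_compose2[of UNIV f] continuous_intros)
next
  case (Suc k)
  then obtain f' where *: "\<And>x. (f has_real_derivative f' x) (at x)" "Dk k f'" by auto
  have "((\<lambda>x. f (a * x + b)) has_real_derivative f' (a * x + b) * a) (at x)" for x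
    by (rule DERIV_chain2[where f = f and g = "\<lambda>x. a * x + b", OF *(1)])
       (auto intro!: derivative_eq_intros)
  then show ?case
    unfolding Dk.simps using *(2)
    by (intro exI[of _ "\<lambda>x. f' (a * x + b) * a"]) (auto intro!: Dk_mult Dk_const Suc.IH)
qed

text \<open>A zero of \<open>g\<close> is harmless if \<open>f\<close> vanishes near it, since the
  quotient is then locally 0 (division by zero yields 0). The exponent \<open>j\<close> is general
  because differentiation raises it: the derivative is f'/g^j - j f g'/g^(j+1), two quotients of the
  same kind.\<close>

lemma Dk_divide_power:
  assumes "Dk k f" "Dk k g" "\<And>x. g x \<noteq> 0 \<or> (\<forall>\<^sub>F y in nhds x. f y = 0)"
  shows "Dk k (\<lambda>x. f x / g x ^ j)"
  using assms
proof (induction k arbitrary: f j)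
  case 0
  have "continuous (at x) (\<lambda>x. f x / g x ^ j)" for x
  proof (cases "g x = 0")
    case True
    with 0 have "\<forall>\<^sub>F y in nhds x. f y = 0" by blast
    then have "\<forall>\<^sub>F y in nhds x. f y / g y ^ j = 0"
      by eventually_elim auto
    then show ?thesis
      using isCont_cong[of "\<lambda>x. f x / g x ^ j" "\<lambda>_. 0" x] by simp
  next
    case False
    then show ?thesis using 0
      by (intro continuous_intros) (auto simp: continuous_on_eq_continuous_at)
  qed
  then show ?case by (simp add: continuous_at_imp_continuous_on)
next
  case (Suc k)
  then obtain f' g' where *: "\<And>x. (f has_real_derivative f' x) (at x)" "Dk k f'"
    "\<And>x. (g has_real_derivative g' x) (at x)" "Dk k g'" by auto
  let ?h = "\<lambda>x. f' x / g x ^ j + (- real j) * ((f x * g' x) / g x ^ Suc j)"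
  \<comment> \<open>The induction needs the new numerators to vanish near the zeros of
    \<open>g\<close> too; local vanishing passes to the derivative.\<close>
  have f'0: "\<forall>\<^sub>F y in nhds x. f' y = 0" if "\<forall>\<^sub>F y in nhds x. f y = 0" for x
  proof -
    obtain S where S: "open S" "x \<in> S" "\<And>y. y \<in> S \<Longrightarrow> f y = 0"
      using \<open>\<forall>\<^sub>F y in nhds x. f y = 0\<close> by (auto simp: eventually_nhds)
    have "f' y = 0" if "y \<in> S" for y
    proof -
      have "(f has_real_derivative 0) (at y) \<longleftrightarrow> ((\<lambda>_. 0) has_real_derivative 0) (at y)"
        by (rule DERIV_cong_ev) (use S that in \<open>auto simp: eventually_nhds\<close>)
      then show ?thesis using *(1)[of y] DERIV_unique by fastforce
    qed
    then show ?thesis using S by (auto simp: eventually_nhds)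
  qed
  have d: "((\<lambda>x. f x / g x ^ j) has_real_derivative ?h x) (at x)" for x
  proof (cases "g x = 0")
    case True
    with Suc have ev: "\<forall>\<^sub>F y in nhds x. f y = 0" by blast
    then have ev2: "\<forall>\<^sub>F y in nhds x. f y / g y ^ j = 0"
      by eventually_elim auto
    have "f' x = 0" "f x = 0" using f'0[OF ev] ev by (auto dest: eventually_nhds_x_imp_x)
    then have "?h x = 0" by simp
    then show ?thesis using DERIV_cong_ev[OF refl ev2 refl, of 0] by simp
  next
    case False
    have "((\<lambda>x. f x / g x ^ j) has_real_derivative
      (f' x * g x ^ j - f x * (real j * g x ^ (j - Suc 0) * g' x)) / (g x ^ j * g x ^ j)) (at x)"
      by (rule DERIV_divide[OF *(1)]) (use False in \<open>auto intro!: derivative_eq_intros *(3)\<close>)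
    moreover have "(f' x * g x ^ j - f x * (real j * g x ^ (j - Suc 0) * g' x)) / (g x ^ j * g x ^ j) = ?h x"
      using False by (cases j) (auto simp: field_simps)
    ultimately show ?thesis by simp
  qed
  have "Dk k ?h"
  proof (intro Dk_add Dk_cmult)
    show "Dk k (\<lambda>x. f' x / g x ^ j)"
      by (rule Suc.IH) (use * Suc.prems(2)[THEN Dk_SucD] Suc.prems(3) f'0 in auto)
    show "Dk k (\<lambda>x. (f x * g' x) / g x ^ Suc j)"
    proof (rule Suc.IH)
      show "g x \<noteq> 0 \<or> (\<forall>\<^sub>F y in nhds x. f y * g' y = 0)" for x
        using Suc.prems(3)[of x] by (auto elim: eventually_mono)
    qed (use * Suc.prems(1,2)[THEN Dk_SucD] in \<open>auto intro!: Dk_mult simp del: Dk.simps\<close>)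
  qed
  then show ?case unfolding Dk.simps using d by (intro exI[of _ ?h] conjI allI)
qed

section \<open>From exp(-1/x) to smooth steps and ramps\<close>

definition flat :: "nat \<Rightarrow> real \<Rightarrow> real" where
  "flat j x = (if x > 0 then (1 / x) ^ j * exp (- 1 / x) else 0)"

text \<open>From the right at 0, the substitution y = 1/x reduces this to y^j / exp y -> 0 at
  infinity.\<close>

lemma flat_tendsto_0: "(flat j \<longlongrightarrow> 0) (at x)" if "x \<le> 0"
proof (cases "x = 0")
  case True
  have "((\<lambda>y. y ^ j / exp y) \<longlongrightarrow> 0) (at_top :: real filter)"
    by (rule tendsto_power_div_exp_0)
  then have "((\<lambda>x::real. inverse x ^ j / exp (inverse x)) \<longlongrightarrow> 0) (at_right 0)"
    by (rule filterlim_compose[OF _ filterlim_inverse_at_top_right])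
  moreover have "\<forall>\<^sub>F x in at_right (0::real). inverse x ^ j / exp (inverse x) = flat j x"
    by (rule eventually_at_right_less[THEN eventually_mono])
       (auto simp: flat_def exp_minus field_simps)
  ultimately have "(flat j \<longlongrightarrow> 0) (at_right 0)" by (rule Lim_transform_eventually)
  moreover have "(flat j \<longlongrightarrow> 0) (at_left 0)"
    by (rule Lim_transform_eventually[OF tendsto_const])
       (auto simp: flat_def eventually_at_left_field intro!: exI[of _ "-1"])
  ultimately show ?thesis using True by (simp add: filterlim_at_split)
next
  case False
  then have "x < 0" using that by simp
  then have "\<forall>\<^sub>F y in nhds x. y < 0" using eventually_nhds_in_open[of "{..<0}" x] by simp
  then have "\<forall>\<^sub>F y in at x. 0 = flat j y"
    unfolding eventually_at_filter by eventually_elim (auto simp: flat_def)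
  then show ?thesis by (rule Lim_transform_eventually[OF tendsto_const])
qed

text \<open>The powers of 1/x are built into the family so that it is closed under differentiation
  up to linear combinations; smoothness of every member then follows by one induction.\<close>

lemma flat_has_derivative:
  "(flat j has_real_derivative (flat (j + 2) x - real j * flat (j + 1) x)) (at x)"
proof (cases "x > 0")
  case True
  have pw: "((\<lambda>x. (1 / x) ^ j) has_real_derivative - real j * (1 / x) ^ (j + 1)) (at x)"
  proof -
    have "((\<lambda>x. 1 / x) has_real_derivative - ((1 / x) * (1 / x))) (at x)"
      using True by (auto intro!: derivative_eq_intros simp: power2_eq_square)
    from DERIV_power[OF this, of j] show ?thesis
    proof (rule DERIV_cong)
      have "real j * (- (y * y) * y ^ (j - Suc 0)) = - real j * y ^ (j + 1)" for y :: real
        by (cases j) (auto simp: algebra_simps)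
      from this[of "1 / x"]
      show "real j * (- (1 / x * (1 / x)) * (1 / x) ^ (j - Suc 0)) = - real j * (1 / x) ^ (j + 1)" .
    qed
  qed
  have "((\<lambda>x. exp (- 1 / x)) has_real_derivative exp (- 1 / x) * ((1 / x) * (1 / x))) (at x)"
    using True by (auto intro!: derivative_eq_intros simp: power2_eq_square)
  from DERIV_mult[OF pw this]
  have "((\<lambda>x. (1 / x) ^ j * exp (- 1 / x)) has_real_derivative
    (flat (j + 2) x - real j * flat (j + 1) x)) (at x)"
    by (rule DERIV_cong) (use True in \<open>simp add: flat_def algebra_simps\<close>)
  moreover have "\<forall>\<^sub>F y in nhds x. y > 0"
    using True eventually_nhds_in_open[of "{0<..}" x] by simp
  then have "\<forall>\<^sub>F y in nhds x. flat j y = (1 / y) ^ j * exp (- 1 / y)"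
    by eventually_elim (auto simp: flat_def)
  ultimately show ?thesis by (subst DERIV_cong_ev[OF refl _ refl]) auto
next
  case False
  then have x: "x \<le> 0" by simp
  \<comment> \<open>At x = 0 the difference quotient is \<open>flat (Suc j) h\<close> itself, and
    for x < 0 it is eventually 0. One majorant from the same family serves both cases.\<close>
  have "((\<lambda>h. (flat j (x + h) - flat j x) / h) \<longlongrightarrow> 0) (at 0)"
  proof (rule Lim_null_comparison)
    have "((\<lambda>h. flat (Suc j) (0 + h)) \<longlongrightarrow> 0) (at 0)"
      using LIM_offset_zero[OF flat_tendsto_0[of 0 "Suc j"]] by simp
    then show "((\<lambda>h. flat (Suc j) h) \<longlongrightarrow> 0) (at 0)" by simp
    show "\<forall>\<^sub>F h in at 0. norm ((flat j (x + h) - flat j x) / h) \<le> flat (Suc j) h"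
    proof (cases "x = 0")
      case True
      then show ?thesis
        by (auto simp: flat_def field_simps)
    next
      case False
      with x have "\<forall>\<^sub>F h in at 0. h < - x"
        by (auto intro!: eventually_at_in_open[of "{..<-x}" 0, simplified, THEN eventually_mono])
      then show ?thesis
        by eventually_elim (use x in \<open>auto simp: flat_def\<close>)
    qed
  qed
  then show ?thesis using x by (simp add: DERIV_def flat_def)
qed

lemma Dk_flat: "Dk k (flat j)"
proof (induction k arbitrary: j)
  case 0
  then show ?case using DERIV_continuous_on[of UNIV "flat j", OF has_field_derivative_at_within[OF flat_has_derivative]]
    by simp
next
  case (Suc k)
  have "Dk k (\<lambda>x. flat (j + 2) x + (- real j) * flat (j + 1) x)"
    by (intro Dk_add Dk_cmult Suc)
  then show ?case
    unfolding Dk.simps using flat_has_derivative[of j]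
    by (intro exI[of _ "\<lambda>x. flat (j + 2) x + (- real j) * flat (j + 1) x"]) auto
qed

definition smooth_step :: "real \<Rightarrow> real" where
  "smooth_step x = flat 0 x / (flat 0 x + flat 0 (1 - x))"

lemma flat_pos: "x > 0 \<Longrightarrow> flat j x > 0" and flat_nonneg: "flat j x \<ge> 0" and flat_0: "x \<le> 0 \<Longrightarrow> flat j x = 0"
  by (auto simp: flat_def)

lemma flat_sum_pos: "flat 0 x + flat 0 (1 - x) > 0"
  using flat_pos[of x 0] flat_pos[of "1 - x" 0] flat_nonneg[of 0 x] flat_nonneg[of 0 "1-x"]
  by (cases "x > 0") (auto intro: add_pos_nonneg add_nonneg_pos)

lemma Dk_smooth_step: "Dk k smooth_step"
proof -
  have "Dk k (\<lambda>x. flat 0 x / (flat 0 x + flat 0 ((-1) * x + 1)) ^ 1)"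
  proof (rule Dk_divide_power[OF Dk_flat Dk_add[OF Dk_flat Dk_compose_affine[OF Dk_flat]]])
    show "flat 0 x + flat 0 (- 1 * x + 1) \<noteq> 0 \<or> (\<forall>\<^sub>F y in nhds x. flat 0 y = 0)" for x
      using flat_sum_pos[of x] by simp
  qed
  then show ?thesis by (simp add: smooth_step_def[abs_def])
qed

lemma smooth_step_0: "x \<le> 0 \<Longrightarrow> smooth_step x = 0"
  and smooth_step_1: "x \<ge> 1 \<Longrightarrow> smooth_step x = 1"
  and smooth_step_bounds: "0 \<le> smooth_step x" "smooth_step x \<le> 1"
  using flat_pos[of x 0] flat_sum_pos[of x] flat_nonneg[of 0 x] flat_nonneg[of 0 "1-x"]
  by (auto simp: smooth_step_def flat_0 field_simps)

text \<open>A smooth stand-in for max 0 x that agrees with it outside (0, 1). Signed sums of shifted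
  and rescaled ramps give smooth trapezoids, because the linear parts cancel exactly.\<close>

definition smooth_ramp :: "real \<Rightarrow> real" where
  "smooth_ramp x = x * smooth_step x"

lemma Dk_smooth_ramp: "Dk k smooth_ramp"
  using Dk_mult[OF Dk_affine[of k 1 0] Dk_smooth_step] by (simp add: smooth_ramp_def[abs_def])

lemma smooth_ramp_0: "x \<le> 0 \<Longrightarrow> smooth_ramp x = 0"
  and smooth_ramp_id: "x \<ge> 1 \<Longrightarrow> smooth_ramp x = x"
  by (auto simp: smooth_ramp_def smooth_step_0 smooth_step_1)

lemma smooth_ramp_approx: "\<bar>smooth_ramp x - max 0 x\<bar> \<le> 1"
proof -
  consider "x \<le> 0" | "x \<ge> 1" | "0 < x" "x < 1" by linarith
  then show ?thesis
  proof cases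
    case 3
    then have "0 \<le> x * smooth_step x" "x * smooth_step x \<le> 1 * 1"
      using smooth_step_bounds[of x] by (auto intro!: mult_le_one)
    then show ?thesis using 3 unfolding smooth_ramp_def by auto
  qed (auto simp: smooth_ramp_0 smooth_ramp_id)
qed

text \<open>These properties of the slope feed a limit argument: rescaled, \<open>q\<close> tends
  pointwise to the indicator of a half line, and its bound supplies the dominating function.\<close>

lemma smooth_ramp_derivative:
  obtains q B where "\<And>x. (smooth_ramp has_real_derivative q x) (at x)"
    "continuous_on UNIV q" "\<And>x. x \<le> 0 \<Longrightarrow> q x = 0" "\<And>x. x \<ge> 1 \<Longrightarrow> q x = 1"
    "\<And>x. \<bar>q x\<bar> \<le> B"
proof -
  obtain q where q: "\<And>x. (smooth_ramp has_real_derivative q x) (at x)" "Dk 0 q"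
    using Dk_smooth_ramp[of "Suc 0"] by auto
  have cont: "continuous_on UNIV q" using q(2) by simp
  have neg: "q x = 0" if "x < 0" for x
  proof -
    have ev: "\<forall>\<^sub>F y in nhds x. smooth_ramp y = 0"
      using eventually_nhds_in_open[of "{..<0}" x, simplified, OF that]
      by eventually_elim (auto simp: smooth_ramp_0)
    have "((\<lambda>_. 0::real) has_real_derivative q x) (at x)"
      using q(1)[of x] DERIV_cong_ev[OF refl ev refl] by blast
    then show ?thesis using DERIV_unique[OF _ DERIV_const] by blast
  qed
  have pos: "q x = 1" if "x > 1" for x
  proof -
    have ev: "\<forall>\<^sub>F y in nhds x. smooth_ramp y = y"
      using eventually_nhds_in_open[of "{1<..}" x, simplified, OF that]
      by eventually_elim (auto simp: smooth_ramp_id)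
    have "((\<lambda>y. y::real) has_real_derivative q x) (at x)"
      using q(1)[of x] DERIV_cong_ev[OF refl ev refl] by blast
    then show ?thesis using DERIV_unique[OF _ DERIV_ident] by blast
  qed
  \<comment> \<open>Comparing with a constant or the identity determines \<open>q\<close> only on
    the open sets x < 0 and x > 1; continuity carries the values to the endpoints.\<close>
  have "continuous (at 0) q" "continuous (at 1) q"
    using cont by (auto simp: continuous_on_eq_continuous_at)
  then have c: "(q \<longlongrightarrow> q 0) (at_left 0)" "(q \<longlongrightarrow> q 1) (at_right 1)"
    by (auto simp: isCont_def filterlim_at_split)
  have "(q \<longlongrightarrow> 0) (at_left 0)"
    by (rule Lim_transform_eventually[OF tendsto_const])
       (auto simp: eventually_at_left_field neg intro!: exI[of _ "-1"])
  with c(1) have q0: "q 0 = 0" using tendsto_unique trivial_limit_at_left_real by blast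
  have "(q \<longlongrightarrow> 1) (at_right 1)"
    by (rule Lim_transform_eventually[OF tendsto_const])
       (auto simp: eventually_at_right_field pos intro!: exI[of _ "2"])
  with c(2) have q1: "q 1 = 1" using tendsto_unique trivial_limit_at_right_real by blast
  have le0: "q x = 0" if "x \<le> 0" for x using neg q0 that by (cases "x = 0") auto
  have ge1: "q x = 1" if "x \<ge> 1" for x using pos q1 that by (cases "x = 1") auto
  have "bounded (q ` {0..1})"
    by (intro compact_imp_bounded compact_continuous_image continuous_on_subset[OF cont]) auto
  then obtain B where B: "\<And>x. x \<in> {0..1} \<Longrightarrow> \<bar>q x\<bar> \<le> B" unfolding bounded_iff by (metis image_eqI real_norm_def)
  have "\<bar>q x\<bar> \<le> max B 1" for x
    using B[of x] le0[of x] ge1[of x] by (cases "x \<le> 0"; cases "x \<ge> 1") auto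
  then show ?thesis using that q(1) cont le0 ge1 by blast
qed

subsection \<open>Smooth functions of several variables\<close>

lemma partial_eq: "(f has_derivative f') (at x) \<Longrightarrow> partial f i x = f' (axis i 1)"
  unfolding partial_def by (drule frechet_derivative_at) simp

lemma Ck_continuous: "Ck k f \<Longrightarrow> continuous_on UNIV f"
  by (cases k) (simp_all add: continuous_at_imp_continuous_on differentiable_imp_continuous_within)

lemma Ck_SucD: "Ck (Suc k) f \<Longrightarrow> Ck k f"
proof (induction k arbitrary: f)
  case 0
  then show ?case using Ck_continuous[OF 0] by simp
next
  case (Suc k)
  have "Ck k (partial f i)" for i
    using Suc.prems Ck.simps(2)[of "Suc k" f] by (intro Suc.IH) iprover
  moreover have "\<forall>x. f differentiable (at x)"
    using Suc.prems Ck.simps(2)[of "Suc k" f] by iprover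
  ultimately show ?case unfolding Ck.simps(2)[of k f] by iprover
qed

text \<open>\<open>partial\<close> is defined through the chosen \<open>frechet_derivative\<close>;
  this lets any explicit formula for the derivative take its place in inductions on
  \<open>k\<close>.\<close>

lemma Ck_cong_partial:
  assumes "\<And>x. (f has_derivative f' x) (at x)" "\<And>i. Ck k (\<lambda>x. f' x (axis i 1))"
  shows "Ck (Suc k) f"
proof -
  have "partial f i = (\<lambda>x. f' x (axis i 1))" for i
    using partial_eq[OF assms(1)] by auto
  then show ?thesis using assms(2) differentiableI[OF assms(1)] by simp
qed

lemma Ck_const: "Ck k (\<lambda>x. c)"
proof (induction k arbitrary: c)
  case (Suc k)
  show ?case by (rule Ck_cong_partial[where f' = "\<lambda>x h. 0"]) (simp_all add: Suc)
qed simp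

lemma Ck_component: "Ck k (\<lambda>x. x $ i)"
proof (cases k)
  case (Suc k)
  show ?thesis unfolding Suc
    by (rule Ck_cong_partial[where f' = "\<lambda>x h. h $ i"])
       (simp_all add: Ck_const bounded_linear_imp_has_derivative bounded_linear_vec_nth)
qed (simp add: continuous_on_component continuous_on_id)

lemma Ck_add: "Ck k f \<Longrightarrow> Ck k g \<Longrightarrow> Ck k (\<lambda>x. f x + g x)"
proof (induction k arbitrary: f g)
  case 0
  then show ?case by (auto intro!: continuous_intros)
next
  case (Suc k)
  from Suc.prems have *: "\<And>x. f differentiable (at x)" "\<And>x. g differentiable (at x)"
    "\<And>i. Ck k (partial f i)" "\<And>i. Ck k (partial g i)" by auto
  show ?case
    by (rule Ck_cong_partial[OF has_derivative_add[OF *(1,2)[unfolded frechet_derivative_works]]])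
       (use * in \<open>auto intro!: Suc.IH simp: partial_def[abs_def]\<close>)
qed

lemma Ck_mult: "Ck k f \<Longrightarrow> Ck k g \<Longrightarrow> Ck k (\<lambda>x. f x * g x)"
proof (induction k arbitrary: f g)
  case 0
  then show ?case by (auto intro!: continuous_intros)
next
  case (Suc k)
  from Suc.prems have *: "\<And>x. f differentiable (at x)" "\<And>x. g differentiable (at x)"
    "\<And>i. Ck k (partial f i)" "\<And>i. Ck k (partial g i)" by auto
  show ?case
  proof (rule Ck_cong_partial[OF has_derivative_mult[OF *(1,2)[unfolded frechet_derivative_works]]])
    fix i
    show "Ck k (\<lambda>x. f x * frechet_derivative g (at x) (axis i 1) +
             frechet_derivative f (at x) (axis i 1) * g x)"
      using * Suc.prems[THEN Ck_SucD]
      by (auto intro!: Ck_add Suc.IH simp: partial_def[abs_def] simp del: Ck.simps)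
  qed
qed

lemma Ck_sum: "finite A \<Longrightarrow> (\<And>i. i \<in> A \<Longrightarrow> Ck k (f i)) \<Longrightarrow> Ck k (\<lambda>x. \<Sum>i\<in>A. f i x)"
  by (induction A rule: finite_induct) (auto intro: Ck_const Ck_add)

lemma Ck_power: "Ck k f \<Longrightarrow> Ck k (\<lambda>x. f x ^ n)"
  by (induction n) (auto intro: Ck_const Ck_mult)

lemma Ck_inner_self: "Ck k (\<lambda>x. x \<bullet> x)"
  unfolding inner_vec_def by (auto intro!: Ck_sum Ck_mult Ck_component)

lemma Ck_compose:
  assumes "Dk k f" "Ck k h"
  shows "Ck k (\<lambda>x. f (h x))"
  using assms
proof (induction k arbitrary: f)
  case 0
  then show ?case by (auto intro!: continuous_on_compose2[of UNIV f])
next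
  case (Suc k)
  then obtain f' where *: "\<And>x. (f has_real_derivative f' x) (at x)" "Dk k f'" by auto
  from Suc.prems have h: "\<And>x. h differentiable (at x)" "\<And>i. Ck k (partial h i)" by auto
  have "((\<lambda>x. f (h x)) has_derivative (\<lambda>v. f' (h x) * frechet_derivative h (at x) v)) (at x)" for x
    using has_derivative_compose[OF h(1)[of x, unfolded frechet_derivative_works]
       *(1)[of "h x", unfolded has_field_derivative_def]] by simp
  then show ?case
    by (rule Ck_cong_partial)
       (use Suc.IH[OF *(2)] h(2) Suc.prems(2)[THEN Ck_SucD] in \<open>auto intro!: Ck_mult simp: partial_def[abs_def]\<close>)
qed

lemma inner_self_power_derivative:
  fixes x :: "real^'n"
  shows "((\<lambda>x::real^'n. (x \<bullet> x) ^ N) has_derivative (\<lambda>h. real N * (x \<bullet> x) ^ (N - 1) * (2 * (x \<bullet> h)))) (at x)"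
  by (auto intro!: derivative_eq_intros simp: inner_commute)

text \<open>Writing |x|^(2N) as the polynomial (x . x)^N keeps the composition smooth at the origin,
  where the norm is not.\<close>

lemma test_fun_radial_field:
  fixes \<eta> :: "real \<Rightarrow> real" and i :: "'n::finite"
  assumes \<eta>: "\<And>k. Dk k \<eta>" and supp: "\<And>t. t > b \<Longrightarrow> \<eta> t = 0" and N: "N > 0"
  shows "test_fun (\<lambda>x::real^'n. x $ i * \<eta> ((x \<bullet> x) ^ N))"
  unfolding test_fun_def
proof (intro conjI allI)
  show "Ck k (\<lambda>x::real^'n. x $ i * \<eta> ((x \<bullet> x) ^ N))" for k
    by (intro Ck_mult Ck_component Ck_compose[OF \<eta>] Ck_power Ck_inner_self)
  \<comment> \<open>A norm above 1 is at most its own 2N-th power, so a bound on t also bounds |x|;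
    hence the maximum with 1.\<close>
  have "norm x \<le> max 1 b" if "\<eta> ((x \<bullet> x) ^ N) \<noteq> 0" for x :: "real^'n"
  proof (rule ccontr)
    assume *: "\<not> norm x \<le> max 1 b"
    then have "norm x \<le> norm x ^ (2 * N)" using N by (intro self_le_power) auto
    also have "\<dots> = (x \<bullet> x) ^ N" by (simp add: power_mult power2_norm_eq_inner)
    finally have "(x \<bullet> x) ^ N > b" using * by auto
    with supp that show False by auto
  qed
  then have "{x::real^'n. x $ i * \<eta> ((x \<bullet> x) ^ N) \<noteq> 0} \<subseteq> cball 0 (max 1 b)" by auto
  then show "compact (closure {x::real^'n. x $ i * \<eta> ((x \<bullet> x) ^ N) \<noteq> 0})"
    by (meson bounded_cball bounded_subset compact_closure)
qed

text \<open>Only the i-th partial of the i-th component is computed, as the components are later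
  summed into a divergence.\<close>

lemma partial_radial_field:
  fixes \<eta> \<eta>' :: "real \<Rightarrow> real" and i :: "'n::finite" and x :: "real^'n"
  assumes "\<And>t. (\<eta> has_real_derivative \<eta>' t) (at t)"
  shows "partial (\<lambda>x. x $ i * \<eta> ((x \<bullet> x) ^ N)) i x
    = \<eta> ((x \<bullet> x) ^ N) + 2 * real N * (x \<bullet> x) ^ (N - 1) * (x $ i)\<^sup>2 * \<eta>' ((x \<bullet> x) ^ N)"
proof -
  have 1: "((\<lambda>x. \<eta> ((x \<bullet> x) ^ N)) has_derivative
      (\<lambda>h. \<eta>' ((x \<bullet> x) ^ N) * (real N * (x \<bullet> x) ^ (N - 1) * (2 * (x \<bullet> h))))) (at x)"
    using has_derivative_compose[OF inner_self_power_derivative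
       assms(1)[of "(x \<bullet> x) ^ N", unfolded has_field_derivative_def]] by simp
  have "((\<lambda>x. x $ i * \<eta> ((x \<bullet> x) ^ N)) has_derivative
     (\<lambda>h. x $ i * (\<eta>' ((x \<bullet> x) ^ N) * (real N * (x \<bullet> x) ^ (N - 1) * (2 * (x \<bullet> h))))
        + h $ i * \<eta> ((x \<bullet> x) ^ N))) (at x)"
    by (intro has_derivative_mult 1 bounded_linear_imp_has_derivative bounded_linear_vec_nth)
  from partial_eq[OF this] show ?thesis
    by (simp add: inner_axis power2_eq_square algebra_simps)
qed

subsection \<open>Integration of radial functions\<close>

text \<open>A ball of radius r has volume proportional to r^d, so the d-th power of the norm has
  constant density on the positive half line. This replaces polar coordinates; the half lines
  \<open>{..a}\<close> determine the measure.\<close>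

lemma distr_norm_power:
  defines "d \<equiv> DIM('a::euclidean_space)"
  shows "distr lborel borel (\<lambda>x::'a. norm x ^ d)
    = density lborel (\<lambda>t. ennreal (unit_ball_vol d) * indicator {0<..} t)" (is "?M = ?D")
proof (rule measure_eqI_generator_eq[where E = "range atMost" and \<Omega> = UNIV and A = "\<lambda>n. {..real n}"])
  have d: "d > 0" by (simp add: d_def)
  have eq: "emeasure ?M {..a} = ennreal (unit_ball_vol d * max 0 a) \<and> emeasure ?D {..a} = ennreal (unit_ball_vol d * max 0 a)" for a :: real
  proof -
    have "emeasure ?M {..a} = emeasure lborel {x::'a. norm x ^ d \<le> a}"
      by (subst emeasure_distr) (auto intro!: arg_cong[of _ _ "emeasure lborel"])
    also have "\<dots> = ennreal (unit_ball_vol d * max 0 a)"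
    proof (cases "a \<ge> 0")
      case True
      have "{x::'a. norm x ^ d \<le> a} = cball 0 (root d a)"
      proof -
        have "norm x ^ d \<le> a \<longleftrightarrow> norm x \<le> root d a" for x :: 'a
          using d True real_root_le_iff[of d "norm x ^ d" a] by (simp add: real_root_power_cancel)
        then show ?thesis by (simp only: set_eq_iff mem_Collect_eq mem_cball_0) simp
      qed
      then show ?thesis using d True
        by (simp add: emeasure_cball real_root_pow_pos2 flip: d_def)
    next
      case False
      then have "{x::'a. norm x ^ d \<le> a} = {}"
        using zero_le_power[OF norm_ge_zero] by (smt (verit) Collect_empty_eq)
      then show ?thesis using False by simp
    qed
    finally have 1: "emeasure ?M {..a} = ennreal (unit_ball_vol d * max 0 a)" .
    have "emeasure ?D {..a} = (\<integral>\<^sup>+ t. ennreal (unit_ball_vol d) * indicator {0<..a} t \<partial>lborel)"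
      by (subst emeasure_density) (auto intro!: nn_integral_cong simp: indicator_def)
    also have "\<dots> = ennreal (unit_ball_vol d) * ennreal (max 0 a)"
      by (subst nn_integral_cmult) (auto simp: max_def)
    also have "\<dots> = ennreal (unit_ball_vol d * max 0 a)"
      by (simp add: ennreal_mult)
    finally show ?thesis using 1 by blast
  qed
  show "Int_stable (range atMost :: real set set)"
    by (auto simp: Int_stable_def)
  show "emeasure ?M X = emeasure ?D X" if "X \<in> range atMost" for X
    using that eq by auto
  show "sets ?M = sigma_sets UNIV (range atMost)" "sets ?D = sigma_sets UNIV (range atMost)"
    by (simp_all add: borel_eq_atMost)
  show "range (\<lambda>n. {..real n}) \<subseteq> range atMost" by auto
  show "(\<Union>i. {..real i}) = UNIV"
    using real_arch_simple by auto
  show "emeasure ?M {..real i} \<noteq> \<infinity>" for i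
    using eq[of i] by simp
qed auto

lemma nn_integral_norm_power:
  fixes f :: "real \<Rightarrow> ennreal"
  assumes [measurable]: "f \<in> borel_measurable borel"
  shows "(\<integral>\<^sup>+ x. f (norm (x::'a::euclidean_space) ^ DIM('a)) \<partial>lborel)
    = ennreal (unit_ball_vol DIM('a)) * (\<integral>\<^sup>+ t. f t * indicator {0<..} t \<partial>lborel)"
proof -
  have "(\<integral>\<^sup>+ x. f (norm (x::'a) ^ DIM('a)) \<partial>lborel)
      = (\<integral>\<^sup>+ t. f t \<partial>distr lborel borel (\<lambda>x::'a. norm x ^ DIM('a)))"
    by (subst nn_integral_distr) auto
  also have "\<dots> = (\<integral>\<^sup>+ t. ennreal (unit_ball_vol DIM('a)) * (f t * indicator {0<..} t) \<partial>lborel)"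
    unfolding distr_norm_power
    by (subst nn_integral_density) (auto intro!: nn_integral_cong simp: mult_ac)
  also have "\<dots> = ennreal (unit_ball_vol DIM('a)) * (\<integral>\<^sup>+ t. f t * indicator {0<..} t \<partial>lborel)"
    by (rule nn_integral_cmult) auto
  finally show ?thesis .
qed

lemma integral_norm_power:
  fixes f :: "real \<Rightarrow> real"
  assumes [measurable]: "f \<in> borel_measurable borel"
  shows "(\<integral> x. f (norm (x::'a::euclidean_space) ^ DIM('a)) \<partial>lborel)
    = unit_ball_vol DIM('a) * (\<integral> t. f t * indicator {0<..} t \<partial>lborel)"
proof -
  have [simp]: "ennreal (unit_ball_vol DIM('a)) * indicator {0<..} t
      = ennreal (unit_ball_vol DIM('a) * indicator {0<..} t)" for t :: real
    by (auto simp: indicator_def)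
  have "(\<integral> x. f (norm (x::'a) ^ DIM('a)) \<partial>lborel)
      = (\<integral> t. f t \<partial>distr lborel borel (\<lambda>x::'a. norm x ^ DIM('a)))"
    by (subst integral_distr) auto
  also have "\<dots> = (\<integral> t. (unit_ball_vol DIM('a) * indicator {0<..} t) *\<^sub>R f t \<partial>lborel)"
    unfolding distr_norm_power by (simp, subst integral_density) auto
  also have "\<dots> = (\<integral> t. unit_ball_vol DIM('a) * (f t * indicator {0<..} t) \<partial>lborel)"
    by (simp add: mult_ac)
  finally show ?thesis by simp
qed

lemma AE_norm_power:
  assumes "AE t in lborel. t > 0 \<longrightarrow> P t" and [measurable]: "Measurable.pred borel P"
  shows "AE x in lborel. P (norm (x::'a::euclidean_space) ^ DIM('a))"
proof -
  have "AE t in distr lborel borel (\<lambda>x::'a. norm x ^ DIM('a)). P t"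
    unfolding distr_norm_power
    by (subst AE_density) (use assms(1) in \<open>auto elim!: eventually_mono simp: indicator_def\<close>)
  then show ?thesis
    by (subst (asm) AE_distr_iff) auto
qed

lemma AE_lborel_scaleR:
  fixes P :: "'a::euclidean_space \<Rightarrow> bool"
  assumes "AE x in lborel. P x" "c \<noteq> 0" and [measurable]: "Measurable.pred borel P"
  shows "AE x in lborel. P (c *\<^sub>R x)"
proof -
  have "AE x in density (distr lborel borel (\<lambda>x. 0 + c *\<^sub>R x)) (\<lambda>_. \<bar>c\<bar> ^ DIM('a)). P x"
    using assms(1) by (subst lborel_affine[OF assms(2), symmetric])
  then have "AE x in distr lborel borel (\<lambda>x. 0 + c *\<^sub>R x). P x"
    using \<open>c \<noteq> 0\<close> by (subst (asm) AE_density) auto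
  then show ?thesis
    by (subst (asm) AE_distr_iff) auto
qed

text \<open>A null set meets almost every ray in a null set, so \<open>u\<close> agrees on one such ray with a Borel
  representative, and radiality spreads this to the whole space.\<close>
lemma radial_borel_profile:
  fixes u :: "real^'n \<Rightarrow> real"
  assumes rad: "radial u" and "u \<in> borel_measurable lebesgue"
  obtains v where "v \<in> borel_measurable borel" "AE x in lborel. u x = v (norm x ^ CARD('n))"
proof -
  define d where "d = CARD('n)"
  have d: "d > 0" by (simp add: d_def)
  obtain u' where u': "u' \<in> borel_measurable lborel" "AE x in lborel. u x = u' x"
    using completion_ex_borel_measurable_real[OF assms(2)] by auto
  have [measurable]: "u' \<in> borel_measurable borel" using u'(1) by simp
  obtain M where M: "M \<in> null_sets lborel" "{x. u x \<noteq> u' x} \<subseteq> M"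
    using u'(2) by (auto simp: eventually_ae_filter)
  have [measurable]: "M \<in> sets borel" using M(1) by auto
  have notM: "AE x in lborel. x \<notin> M" using M(1) by (rule AE_not_in)
  \<comment> \<open>For each fixed s other than 0 the dilated null set is null. Exchanging the two
    quantifiers by Fubini then yields a direction whose ray almost avoids \<open>M\<close>.\<close>
  have "AE s in lborel. AE x::real^'n in lborel. root d s *\<^sub>R x \<notin> M"
    using AE_lborel_singleton[of "0::real"]
  proof eventually_elim
    case (elim s)
    then have "root d s \<noteq> 0" using d by simp
    from AE_lborel_scaleR[OF notM this] show ?case by simp
  qed
  then have "AE x::real^'n in lborel. AE s in lborel. root d s *\<^sub>R x \<notin> M"
    by (subst lborel_pair.AE_commute) measurable
  moreover have "AE x::real^'n in lborel. x \<noteq> 0" by (rule AE_lborel_singleton)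
  ultimately have "AE x::real^'n in lborel. x \<noteq> 0 \<and> (AE s in lborel. root d s *\<^sub>R x \<notin> M)"
    by eventually_elim auto
  moreover have "ae_filter (lborel :: (real^'n) measure) \<noteq> bot"
    by (simp add: ae_filter_eq_bot_iff)
  ultimately have "\<exists>x::real^'n. x \<noteq> 0 \<and> (AE s in lborel. root d s *\<^sub>R x \<notin> M)"
    by (rule eventually_happens'[rotated])
  then obtain x0 :: "real^'n" where x0: "x0 \<noteq> 0" "AE s in lborel. root d s *\<^sub>R x0 \<notin> M"
    by blast
  \<comment> \<open>The point in the argument of \<open>u'\<close> lies on the chosen ray and, for t
    > 0, has norm \<open>root d t\<close>, which makes \<open>v\<close> the Borel representative
    read along that ray.\<close>
  define v where "v t = u' (root d (t / norm x0 ^ d) *\<^sub>R x0)" for t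
  have v: "v \<in> borel_measurable borel" unfolding v_def by measurable
  have "1 / norm x0 ^ d \<noteq> 0" using x0(1) by simp
  from AE_lborel_scaleR[OF x0(2) this]
  have "AE t in lborel. root d ((1 / norm x0 ^ d) *\<^sub>R t) *\<^sub>R x0 \<notin> M"
    by measurable
  then have *: "AE t in lborel. t > 0 \<longrightarrow> root d (t / norm x0 ^ d) *\<^sub>R x0 \<notin> M"
    by (rule eventually_mono) simp
  have "AE x::real^'n in lborel. root d (norm x ^ DIM(real^'n) / norm x0 ^ d) *\<^sub>R x0 \<notin> M"
    by (rule AE_norm_power[OF *]) measurable
  then have "AE x::real^'n in lborel. root d (norm x ^ d / norm x0 ^ d) *\<^sub>R x0 \<notin> M"
    by (simp add: d_def)
  then have "AE x in lborel. u x = v (norm x ^ d)"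
  proof eventually_elim
    case (elim x)
    have "root d (norm x ^ d / norm x0 ^ d) = norm x / norm x0"
      using d real_root_power_cancel[of d "norm x / norm x0"] by (simp add: power_divide)
    then have "norm (root d (norm x ^ d / norm x0 ^ d) *\<^sub>R x0) = norm x"
      using x0 by simp
    then have "u x = u (root d (norm x ^ d / norm x0 ^ d) *\<^sub>R x0)"
      using rad unfolding radial_def by metis
    also have "\<dots> = v (norm x ^ d)" using elim M(2) by (auto simp: v_def)
    finally show ?case .
  qed
  then show ?thesis using that v by (simp add: d_def)
qed

subsection \<open>The inequalities of Moser and Ruf on the half line\<close>

text \<open>The sum over deficit levels k: a level set is covered by intervals of logarithmic length
  2(k+1) and 20(k+1), and carries the weight exp(-k).\<close>

definition moser_const :: real where
  "moser_const = (\<Sum>k. 22 * (real k + 1) * exp (- real k))"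

lemma summable_moser: "summable (\<lambda>k. 22 * (real k + 1) * exp (- real k))"
proof -
  have "summable (\<lambda>k. of_nat (Suc k) * exp (-1::real) ^ k)"
    using geometric_deriv_sums[of "exp (-1::real)"] by (auto simp: sums_iff)
  then have "summable (\<lambda>k. 22 * (of_nat (Suc k) * exp (-1::real) ^ k))"
    by (rule summable_mult)
  then show ?thesis
    by (rule summable_cong[THEN iffD1, rotated]) (auto simp: algebra_simps simp flip: exp_of_nat_mult)
qed

lemma moser_const_nonneg: "moser_const \<ge> 0"
  unfolding moser_const_def by (rule suminf_nonneg[OF summable_moser]) auto

lemma nn_integral_inverse_Icc:
  assumes "0 < a" "a \<le> b"
  shows "(\<integral>\<^sup>+ t. ennreal (1 / t) * indicator {a..b} t \<partial>lborel) = ennreal (ln (b / a))"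
proof -
  have "(\<integral>\<^sup>+ t. ennreal (1 / t) * indicator {a..b} t \<partial>lborel) = ln b - ln a"
    using assms by (intro nn_integral_FTC_Icc) (auto intro!: derivative_eq_intros)
  then show ?thesis using assms by (simp add: ln_div)
qed

text \<open>Moser's argument: where \<open>f\<close> nearly exhausts its energy budget, hardly any energy is left
  further in, so \<open>f\<close> stays nearly constant there and cannot keep up with the logarithm.\<close>
lemma moser_level_diameter:
  fixes La Lb x y m m' l :: real
  assumes "l > 0" "Lb \<ge> 2 * l" "La > Lb" "La - l \<le> x\<^sup>2" "Lb - l \<le> y\<^sup>2"
    and "(x - y)\<^sup>2 \<le> m * (La - Lb)" "y\<^sup>2 \<le> m' * Lb" "m + m' \<le> 1" "0 \<le> m"
  shows "La - Lb \<le> 20 * l"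
proof -
  define \<delta> where "\<delta> = La - Lb"
  have \<delta>: "\<delta> > 0" using assms by (simp add: \<delta>_def)
  \<comment> \<open>The outer point attains its budget \<open>m' * Lb\<close> up to
    \<open>l\<close>, so at most the fraction l/Lb of the energy remains for the inner shell. By Lb
    >= 2l this fraction is at most 1/2.\<close>
  have "m * Lb \<le> (1 - m') * Lb" using assms by (intro mult_right_mono) auto
  also have "\<dots> \<le> l" using assms by (simp add: algebra_simps)
  finally have mLb: "m * Lb \<le> l" .
  have "m * \<delta> * Lb \<le> l * \<delta>" using mLb \<delta> by (simp add: mult.commute mult.left_commute)
  have y: "y\<^sup>2 \<le> Lb"
  proof -
    have "m' * Lb \<le> 1 * Lb" using assms by (intro mult_right_mono) auto
    then show ?thesis using assms by linarith
  qed
  have xy: "(x - y)\<^sup>2 \<le> \<delta> / 2"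
  proof -
    have "m * (2 * l) \<le> m * Lb" using assms by (intro mult_left_mono) auto
    then have "l * (2 * m) \<le> l * 1" using mLb by (simp add: mult_ac)
    then have "m \<le> 1 / 2" using assms(1) by (subst (asm) mult_le_cancel_left_pos) auto
    then have "m * \<delta> \<le> 1 / 2 * \<delta>" using \<delta> by (intro mult_right_mono) auto
    then show ?thesis using assms(6) unfolding \<delta>_def by linarith
  qed
  have cross: "\<bar>y * (x - y)\<bar> \<le> sqrt (l * \<delta>)"
  proof (rule real_le_rsqrt)
    have "\<bar>y * (x - y)\<bar>\<^sup>2 = y\<^sup>2 * (x - y)\<^sup>2" by (simp add: power_mult_distrib)
    also have "\<dots> \<le> Lb * (m * \<delta>)" using y assms by (intro mult_mono) (auto simp: \<delta>_def)
    also have "\<dots> \<le> l * \<delta>" using \<open>m * \<delta> * Lb \<le> l * \<delta>\<close> by (simp add: mult_ac)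
    finally show "\<bar>y * (x - y)\<bar>\<^sup>2 \<le> l * \<delta>" .
  qed
  have "x\<^sup>2 = y\<^sup>2 + 2 * (y * (x - y)) + (x - y)\<^sup>2" by (simp add: power2_eq_square algebra_simps)
  also have "\<dots> \<le> Lb + 2 * sqrt (l * \<delta>) + \<delta> / 2" using y xy cross by linarith
  finally have "\<delta> / 2 \<le> l + 2 * sqrt (l * \<delta>)" using assms by (simp add: \<delta>_def field_simps)
  \<comment> \<open>The weights 4l and \<delta>/4 are chosen so that twice the root costs \<delta>/4
    + 4l. Then \<delta>/2 <= 5l + \<delta>/4, whence the constant 20.\<close>
  moreover have "sqrt (l * \<delta>) \<le> \<delta> / 8 + 2 * l"
    using arith_geo_mean_sqrt[of "4 * l" "\<delta> / 4"] assms \<delta> by (simp add: field_simps)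
  ultimately have "\<delta> \<le> 20 * l" by linarith
  then show ?thesis by (simp add: \<delta>_def)
qed

text \<open>In the coordinate L = ln(T/t), a deficit of at least k gives exp(f^2) <= exp(-k) T/t,
  and dt/t is length in L. So a level set costs exp(-k) T times its logarithmic length, which the
  diameter estimate makes linear in k. \<open>bdry\<close> is the oscillation bound for a function
  normalised to vanish at \<open>T\<close>.\<close>

lemma moser_inequality:
  fixes f :: "real \<Rightarrow> real" and m :: "real \<Rightarrow> real \<Rightarrow> real"
  assumes T: "T > 0" and G: "AE t in lborel. t > 0 \<longrightarrow> t \<in> G"
    and osc: "\<And>a b. a \<in> G \<Longrightarrow> b \<in> G \<Longrightarrow> 0 < a \<Longrightarrow> a < b \<Longrightarrow> b < T \<Longrightarrow> (f a - f b)\<^sup>2 \<le> m a b * ln (b / a)"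
    and bdry: "\<And>a. a \<in> G \<Longrightarrow> 0 < a \<Longrightarrow> a < T \<Longrightarrow> (f a)\<^sup>2 \<le> m a T * ln (T / a)"
    and m0: "\<And>a b. 0 \<le> m a b" and m1: "\<And>a. 0 < a \<Longrightarrow> a < T \<Longrightarrow> m a T \<le> 1"
    and madd: "\<And>a b. 0 < a \<Longrightarrow> a < b \<Longrightarrow> b < T \<Longrightarrow> m a b + m b T \<le> 1"
  shows "(\<integral>\<^sup>+ t. ennreal (exp ((f t)\<^sup>2)) * indicator {0<..<T} t \<partial>lborel) \<le> ennreal (moser_const * T)"
proof -
  define L where "L t = ln (T / t)" for t
  \<comment> \<open>The diameter estimate requires L >= 2(k+1); points of the level with smaller L
    are covered separately by \<open>J1\<close>.\<close>
  define X where "X k = {L t | t. t \<in> G \<and> 0 < t \<and> t < T \<and> L t - (f t)\<^sup>2 \<le> real k + 1 \<and> L t \<ge> 2 * (real k + 1)}" for k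
  have "\<exists>s. X k \<subseteq> {s..s + 20 * (real k + 1)}" for k
  proof (cases "X k = {}")
    case False
    have bdd: "bdd_below (X k)" by (rule bdd_belowI[of _ 0]) (auto simp: X_def)
    have diam: "p \<le> q + 20 * (real k + 1)" if pq: "p \<in> X k" "q \<in> X k" for p q
    proof (cases "p \<le> q")
      case False
      from pq obtain a b where a: "p = L a" "a \<in> G" "0 < a" "a < T" "L a - (f a)\<^sup>2 \<le> real k + 1"
        and b: "q = L b" "b \<in> G" "0 < b" "b < T" "L b - (f b)\<^sup>2 \<le> real k + 1" "L b \<ge> 2 * (real k + 1)"
        by (auto simp: X_def)
      have ab: "a < b" using False a b T by (simp add: L_def ln_div)
      have "L a - L b \<le> 20 * (real k + 1)"
      proof (rule moser_level_diameter[where x = "f a" and y = "f b" and m = "m a b" and m' = "m b T"])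
        show "(f a - f b)\<^sup>2 \<le> m a b * (L a - L b)"
          using osc[of a b] a b ab T by (simp add: L_def ln_div)
        show "(f b)\<^sup>2 \<le> m b T * L b" using bdry[of b] b by (simp add: L_def)
        show "m a b + m b T \<le> 1" using madd a b ab by simp
        show "L b < L a" using False a b by simp
      qed (use a b m0 in auto)
      then show ?thesis using a b by simp
    qed auto
    show ?thesis
    proof (intro exI[of _ "Inf (X k)"] subsetI)
      fix p assume p: "p \<in> X k"
      have "p - 20 * (real k + 1) \<le> Inf (X k)"
        using False by (rule cInf_greatest) (use diam[OF p] in \<open>auto simp: algebra_simps\<close>)
      then show "p \<in> {Inf (X k)..Inf (X k) + 20 * (real k + 1)}"
        using cInf_lower[OF p bdd] by simp
    qed
  qed auto
  then obtain s where s: "\<And>k. X k \<subseteq> {s k..s k + 20 * (real k + 1)}" by metis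
  \<comment> \<open>In the coordinate L, \<open>J1 k\<close> is [0, 2(k+1)] and \<open>J2 k\<close>
    is [s k, s k + 20(k+1)].\<close>
  define J1 where "J1 k = {T * exp (- (2 * (real k + 1)))..T}" for k :: nat
  define J2 where "J2 k = {T * exp (- (s k + 20 * (real k + 1)))..T * exp (- s k)}" for k
  \<comment> \<open>The indicators are added because the two intervals may overlap; the majorant
    only needs their sum to be at least 1 on the level set.\<close>
  define g where "g k t = ennreal (exp (- real k) * T) *
    (ennreal (1 / t) * indicator (J1 k) t + ennreal (1 / t) * indicator (J2 k) t)" for k t
  have [measurable]: "J1 k \<in> sets borel" "J2 k \<in> sets borel" for k by (auto simp: J1_def J2_def)
  have [measurable]: "g k \<in> borel_measurable lborel" for k unfolding g_def by measurable
  have int: "(\<integral>\<^sup>+ t. g k t \<partial>lborel) = ennreal (22 * (real k + 1) * exp (- real k) * T)" for k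
  proof -
    have 1: "(\<integral>\<^sup>+ t. ennreal (1 / t) * indicator (J1 k) t \<partial>lborel) = ennreal (2 * (real k + 1))"
      unfolding J1_def by (subst nn_integral_inverse_Icc) (use T in \<open>auto simp: ln_div ln_mult\<close>)
    have 2: "(\<integral>\<^sup>+ t. ennreal (1 / t) * indicator (J2 k) t \<partial>lborel) = ennreal (20 * (real k + 1))"
      unfolding J2_def
      by (subst nn_integral_inverse_Icc) (use T in \<open>auto simp: ln_div ln_mult\<close>)
    have "(\<integral>\<^sup>+ t. g k t \<partial>lborel) = ennreal (exp (- real k) * T) *
      (ennreal (2 * (real k + 1)) + ennreal (20 * (real k + 1)))"
      unfolding g_def by (simp add: nn_integral_cmult nn_integral_add 1 2 del: ennreal_plus)
    also have "\<dots> = ennreal (exp (- real k) * T * (2 * (real k + 1) + 20 * (real k + 1)))"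
      using T by (simp add: ennreal_mult flip: ennreal_plus)
    finally show ?thesis by (simp add: algebra_simps)
  qed
  have "AE t in lborel. ennreal (exp ((f t)\<^sup>2)) * indicator {0<..<T} t \<le> (\<Sum>k. g k t)"
    using G
  proof eventually_elim
    case (elim t)
    show ?case
    proof (cases "t \<in> {0<..<T}")
      case True
      then have t: "0 < t" "t < T" "t \<in> G" using elim by auto
      have L0: "L t > 0" using t by (simp add: L_def)
      have "(f t)\<^sup>2 \<le> 1 * L t"
        using bdry[OF t(3,1,2)] mult_right_mono[OF m1[OF t(1,2)], of "L t"] L0
        unfolding L_def by linarith
      then have F0: "L t - (f t)\<^sup>2 \<ge> 0" by simp
      \<comment> \<open>Rounding the deficit down puts t in level k: the lower bound k gives the
        decay, the upper bound k+1 the diameter.\<close>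
      define k where "k = nat \<lfloor>L t - (f t)\<^sup>2\<rfloor>"
      have k: "real k \<le> L t - (f t)\<^sup>2" "L t - (f t)\<^sup>2 \<le> real k + 1"
        using F0 unfolding k_def by linarith+
      have tL: "t = T * exp (- L t)" using t T by (simp add: L_def exp_minus)
      have "t \<in> J1 k \<or> t \<in> J2 k"
      proof (cases "L t \<ge> 2 * (real k + 1)")
        case True
        then have "L t \<in> X k" using t k by (auto simp: X_def)
        with s have "L t \<in> {s k..s k + 20 * (real k + 1)}" by blast
        then have "T * exp (- (s k + 20 * (real k + 1))) \<le> T * exp (- L t)" "T * exp (- L t) \<le> T * exp (- s k)"
          using T by auto
        then show ?thesis using tL unfolding J2_def by auto
      next
        case False
        then have "T * exp (- (2 * (real k + 1))) \<le> T * exp (- L t)" using T by auto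
        then show ?thesis using tL t unfolding J1_def by auto
      qed
      then have ge1: "1 \<le> (indicator (J1 k) t + indicator (J2 k) t :: ennreal)"
        by (auto simp: indicator_def)
      have "exp ((f t)\<^sup>2) \<le> exp (L t - real k)" using k by simp
      also have "\<dots> = exp (- real k) * T * (1 / t)"
        using t T by (simp add: L_def exp_diff exp_minus field_simps)
      finally have "ennreal (exp ((f t)\<^sup>2)) \<le> ennreal (exp (- real k) * T * (1 / t)) * 1"
        by (simp add: ennreal_leI)
      also have "\<dots> \<le> ennreal (exp (- real k) * T * (1 / t)) * (indicator (J1 k) t + indicator (J2 k) t)"
        by (rule mult_left_mono[OF ge1]) simp
      also have "\<dots> = g k t"
        using T t unfolding g_def by (subst ennreal_mult) (auto simp: algebra_simps)
      also have "\<dots> \<le> (\<Sum>k. g k t)"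
        using sum_le_suminf[of "\<lambda>k. g k t" "{k}"] by simp
      finally show ?thesis using True by simp
    qed simp
  qed
  then have "(\<integral>\<^sup>+ t. ennreal (exp ((f t)\<^sup>2)) * indicator {0<..<T} t \<partial>lborel) \<le> (\<integral>\<^sup>+ t. (\<Sum>k. g k t) \<partial>lborel)"
    by (rule nn_integral_mono_AE)
  also have "\<dots> = (\<Sum>k. \<integral>\<^sup>+ t. g k t \<partial>lborel)" by (rule nn_integral_suminf) measurable
  also have "\<dots> = ennreal (\<Sum>k. 22 * (real k + 1) * exp (- real k) * T)"
    unfolding int by (rule suminf_ennreal2) (use T summable_mult2[OF summable_moser] in auto)
  also have "(\<Sum>k. 22 * (real k + 1) * exp (- real k) * T) = moser_const * T"
    unfolding moser_const_def by (rule suminf_mult2[OF summable_moser, symmetric])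
  finally show ?thesis .
qed

text \<open>\<open>D\<close> bounds the L2 part of the norm, and only 1-D is left for the energy
  \<open>m\<close>. Inside a cut the difference to the value there, scaled by sqrt(1+D), meets the
  hypotheses of \<open>moser_inequality\<close>; outside it \<open>w\<close> is bounded and the
  integrand is controlled by w^2.\<close>

lemma ruf_inequality:
  fixes w :: "real \<Rightarrow> real" and m :: "real \<Rightarrow> real \<Rightarrow> real"
  assumes c: "c > 0" and D: "0 \<le> D" and [measurable]: "w \<in> borel_measurable borel"
    and G: "AE t in lborel. t > 0 \<longrightarrow> t \<in> G"
    and osc: "\<And>a b. a \<in> G \<Longrightarrow> b \<in> G \<Longrightarrow> 0 < a \<Longrightarrow> a < b \<Longrightarrow> (w a - w b)\<^sup>2 \<le> m a b * ln (b / a)"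
    and m0: "\<And>a b. 0 \<le> m a b" and m1: "\<And>a b. m a b \<le> 1 - D"
    and madd: "\<And>a b c. a < b \<Longrightarrow> b < c \<Longrightarrow> m a b + m b c \<le> 1 - D"
    and L2: "(\<integral>\<^sup>+ t. ennreal (c * (w t)\<^sup>2) * indicator {0<..} t \<partial>lborel) \<le> ennreal D"
  shows "(\<integral>\<^sup>+ t. ennreal (exp ((w t)\<^sup>2) - 1) * indicator {0<..} t \<partial>lborel)
    \<le> ennreal (exp 2 * moser_const * (4 / c) + exp 4 / c)"
proof (cases "D = 0")
  case True
  then have "AE t in lborel. ennreal (c * (w t)\<^sup>2) * indicator {0<..} t = 0"
    using L2 by (subst nn_integral_0_iff_AE[symmetric]) auto
  then have "AE t in lborel. ennreal (exp ((w t)\<^sup>2) - 1) * indicator {0<..} t = 0"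
    by eventually_elim (use c in \<open>auto simp: indicator_def ennreal_eq_0_iff mult_le_0_iff split: if_splits\<close>)
  then have "(\<integral>\<^sup>+ t. ennreal (exp ((w t)\<^sup>2) - 1) * indicator {0<..} t \<partial>lborel) = 0"
    by (subst nn_integral_0_iff_AE) auto
  then show ?thesis by simp
next
  case False
  with D have Dpos: "D > 0" by simp
  have D1: "D \<le> 1" using m0[of 0 0] m1[of 0 0] by linarith
  \<comment> \<open>If w^2 exceeded 2D/(c \<tau>) almost everywhere on [\<tau>, 2\<tau>], the
    weighted L2 integral would be at least 2D. This contradicts the bound D only if D > 0, which is
    why D = 0 is treated first.\<close>
  have pick: "\<exists>s\<in>G. \<tau> \<le> s \<and> s \<le> 2 * \<tau> \<and> (w s)\<^sup>2 \<le> 2 * D / (c * \<tau>)" if \<tau>: "\<tau> > 0" for \<tau>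
  proof (rule ccontr)
    assume *: "\<not> ?thesis"
    have "ennreal (2 * D) = (\<integral>\<^sup>+ t. ennreal (2 * D / \<tau>) * indicator {\<tau>..2 * \<tau>} t \<partial>lborel)"
      using \<tau> D by (subst nn_integral_cmult_indicator) (auto simp flip: ennreal_mult)
    also have "\<dots> \<le> (\<integral>\<^sup>+ t. ennreal (c * (w t)\<^sup>2) * indicator {0<..} t \<partial>lborel)"
    proof (rule nn_integral_mono_AE, use G in eventually_elim)
      case (elim t)
      show ?case
      proof (cases "t \<in> {\<tau>..2 * \<tau>}")
        case True
        then have "(w t)\<^sup>2 > 2 * D / (c * \<tau>)" using * elim \<tau> by force
        then have "c * (w t)\<^sup>2 \<ge> 2 * D / \<tau>" using c \<tau> by (simp add: field_simps)
        then show ?thesis using True \<tau> by (auto intro!: ennreal_leI)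
      qed simp
    qed
    also have "\<dots> \<le> ennreal D" by fact
    finally show False using Dpos by (simp add: ennreal_le_iff)
  qed
  \<comment> \<open>With this value 2D/(cT) = D, so the selected point satisfies w(\<tau>)^2 <=
    D.\<close>
  define T where "T = 2 / c"
  have T: "T > 0" using c by (simp add: T_def)
  obtain \<tau> where \<tau>: "\<tau> \<in> G" "T \<le> \<tau>" "\<tau> \<le> 2 * T" "(w \<tau>)\<^sup>2 \<le> D"
    using pick[OF T] c by (auto simp: T_def)
  have \<tau>0: "\<tau> > 0" using \<tau> T by simp
  \<comment> \<open>The factor sqrt(1+D) multiplies the energy by 1+D, and (1+D)(1-D) <= 1 stays
    within Moser's budget.\<close>
  define f where "f t = sqrt (1 + D) * (w t - w \<tau>)" for t
  have f2: "(f a - f b)\<^sup>2 = (1 + D) * (w a - w b)\<^sup>2" for a b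
    using D by (simp add: f_def power_mult_distrib flip: right_diff_distrib)
  have D2: "(1 + D) * (1 - D) \<le> 1" by (simp add: algebra_simps)
  have inner: "(\<integral>\<^sup>+ t. ennreal (exp ((f t)\<^sup>2)) * indicator {0<..<\<tau>} t \<partial>lborel) \<le> ennreal (moser_const * \<tau>)"
  proof (rule moser_inequality[where G = G and m = "\<lambda>a b. (1 + D) * m a b"])
    show "(f a - f b)\<^sup>2 \<le> (1 + D) * m a b * ln (b / a)" if "a \<in> G" "b \<in> G" "0 < a" "a < b" for a b
      using mult_left_mono[OF osc[OF that], of "1 + D"] D by (simp add: f2)
    then show "(f a)\<^sup>2 \<le> (1 + D) * m a \<tau> * ln (\<tau> / a)" if "a \<in> G" "0 < a" "a < \<tau>" for a
      using that \<tau> f_def[of \<tau>] by (metis diff_self diff_zero mult_zero_right)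
    show "(1 + D) * m a b + (1 + D) * m b \<tau> \<le> 1" if "a < b" "b < \<tau>" for a b
      using mult_left_mono[OF madd[OF that], of "1 + D"] D D2
      by (simp only: distrib_left[symmetric]) linarith
    show "(1 + D) * m a \<tau> \<le> 1" for a
      using mult_left_mono[OF m1[of a \<tau>], of "1 + D"] D D2 by linarith
  qed (use \<tau>0 G m0 D in auto)
  have "(\<integral>\<^sup>+ t. ennreal (exp ((w t)\<^sup>2) - 1) * indicator {0<..} t \<partial>lborel)
    \<le> (\<integral>\<^sup>+ t. ennreal (exp 2) * (ennreal (exp ((f t)\<^sup>2)) * indicator {0<..<\<tau>} t)
        + ennreal (exp 4 / c) * (ennreal (c * (w t)\<^sup>2) * indicator {0<..} t) \<partial>lborel)"
  proof (rule nn_integral_mono_AE)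
    show "AE t in lborel. ennreal (exp ((w t)\<^sup>2) - 1) * indicator {0<..} t
      \<le> ennreal (exp 2) * (ennreal (exp ((f t)\<^sup>2)) * indicator {0<..<\<tau>} t)
        + ennreal (exp 4 / c) * (ennreal (c * (w t)\<^sup>2) * indicator {0<..} t)"
      using G
    proof eventually_elim
      case (elim t)
      consider "t \<le> 0" | "0 < t" "t < \<tau>" | "0 < t" "t \<ge> \<tau>" by linarith
      then show ?case
      proof cases
        case 2
        define x where "x = w t - w \<tau>"
        \<comment> \<open>Young's inequality with weight D: after division by D the cross term is at
          most D x^2 + 1. Together with w(\<tau>)^2 <= D <= 1 this gives w(t)^2 <= f(t)^2 +
          2.\<close>
        have "0 \<le> (D * x - w \<tau>)\<^sup>2" by simp
        then have "2 * D * x * w \<tau> \<le> D\<^sup>2 * x\<^sup>2 + (w \<tau>)\<^sup>2" by (simp add: power2_eq_square algebra_simps)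
        also have "\<dots> \<le> D\<^sup>2 * x\<^sup>2 + D" using \<tau> by simp
        also have "\<dots> = D * (D * x\<^sup>2 + 1)" by (simp add: power2_eq_square algebra_simps)
        finally have "D * (2 * x * w \<tau>) \<le> D * (D * x\<^sup>2 + 1)" by (simp add: mult_ac)
        then have "2 * x * w \<tau> \<le> D * x\<^sup>2 + 1" using Dpos by simp
        moreover have "(w t)\<^sup>2 = x\<^sup>2 + 2 * x * w \<tau> + (w \<tau>)\<^sup>2"
          by (simp add: x_def power2_eq_square algebra_simps)
        moreover have "(f t)\<^sup>2 = (1 + D) * x\<^sup>2" using D by (simp add: f_def x_def power_mult_distrib)
        ultimately have "(w t)\<^sup>2 \<le> 2 + (f t)\<^sup>2" using \<tau> D1 by (simp add: algebra_simps)
        then have "exp ((w t)\<^sup>2) - 1 \<le> exp 2 * exp ((f t)\<^sup>2)"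
          by (smt (verit) exp_add exp_le_cancel_iff)
        then have "ennreal (exp ((w t)\<^sup>2) - 1) \<le> ennreal (exp 2) * ennreal (exp ((f t)\<^sup>2))"
          by (simp add: ennreal_leI flip: ennreal_mult)
        then show ?thesis using 2 by (simp add: add_increasing2)
      next
        case 3
        have tG: "t \<in> G" using elim 3 by simp
        \<comment> \<open>Beyond the cut some s in [t, 2t] has |w(s)| <= 1, and the oscillation from
          t to s is at most 1 because ln(s/t) <= 1. Hence |w(t)| <= 2 and exp(w^2) - 1 <= exp(4)
          w^2.\<close>
        obtain s where s: "s \<in> G" "t \<le> s" "s \<le> 2 * t" "(w s)\<^sup>2 \<le> 2 * D / (c * t)" using pick[OF 3(1)] by auto
        have "2 * D / (c * t) \<le> 1"
        proof -
          have "c * t \<ge> c * T" using 3 \<tau> c by simp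
          then show ?thesis using D1 c D by (simp add: T_def)
        qed
        then have "\<bar>w s\<bar> \<le> 1" using s abs_le_square_iff[of "w s" 1] by simp
        moreover have "\<bar>w t - w s\<bar> \<le> 1"
        proof (cases "s = t")
          case False
          then have ts: "t < s" using s by simp
          have "(w t - w s)\<^sup>2 \<le> m t s * ln (s / t)" by (rule osc[OF tG s(1) 3(1) ts])
          also have "\<dots> \<le> 1 * 1"
          proof (rule mult_mono)
            show "m t s \<le> 1" using m1[of t s] D by simp
            have "ln (s / t) \<le> s / t - 1" using 3 ts by (intro ln_le_minus_one) simp
            also have "\<dots> \<le> 1" using 3 s by (simp add: field_simps)
            finally show "ln (s / t) \<le> 1" .
          qed (use 3 ts in auto)
          finally show ?thesis using abs_le_square_iff[of "w t - w s" 1] by simp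
        qed simp
        ultimately have "\<bar>w t\<bar> \<le> 2" by linarith
        then have w4: "(w t)\<^sup>2 \<le> 4" using abs_le_square_iff[of "w t" 2] by simp
        have "1 - (w t)\<^sup>2 \<le> exp (- (w t)\<^sup>2)" using exp_ge_add_one_self[of "- (w t)\<^sup>2"] by simp
        then have "(1 - (w t)\<^sup>2) * exp ((w t)\<^sup>2) \<le> exp (- (w t)\<^sup>2) * exp ((w t)\<^sup>2)"
          by (intro mult_right_mono) auto
        then have "exp ((w t)\<^sup>2) - 1 \<le> (w t)\<^sup>2 * exp ((w t)\<^sup>2)"
          by (simp add: exp_minus algebra_simps)
        also have "\<dots> \<le> (w t)\<^sup>2 * exp 4" using w4 by (intro mult_left_mono) auto
        also have "\<dots> = exp 4 / c * (c * (w t)\<^sup>2)" using c by simp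
        finally have "ennreal (exp ((w t)\<^sup>2) - 1) \<le> ennreal (exp 4 / c) * ennreal (c * (w t)\<^sup>2)"
          using c by (simp add: ennreal_leI flip: ennreal_mult)
        then show ?thesis using 3 by simp
      qed simp
    qed
  qed
  also have "\<dots> = ennreal (exp 2) * (\<integral>\<^sup>+ t. (ennreal (exp ((f t)\<^sup>2)) * indicator {0<..<\<tau>} t) \<partial>lborel)
        + ennreal (exp 4 / c) * (\<integral>\<^sup>+ t. ennreal (c * (w t)\<^sup>2) * indicator {0<..} t \<partial>lborel)"
    unfolding f_def by (subst nn_integral_add) (auto simp: nn_integral_cmult)
  also have "\<dots> \<le> ennreal (exp 2) * ennreal (moser_const * \<tau>) + ennreal (exp 4 / c) * ennreal D"
    using inner L2 by (intro add_mono mult_left_mono) auto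
  also have "\<dots> = ennreal (exp 2 * (moser_const * \<tau>) + exp 4 / c * D)"
    using \<tau>0 c D moser_const_nonneg
    by (subst (1 2) ennreal_mult[symmetric]) (auto simp del: ennreal_plus simp flip: ennreal_plus)
  also have "\<dots> \<le> ennreal (exp 2 * moser_const * (4 / c) + exp 4 / c)"
  proof (intro ennreal_leI add_mono)
    have "moser_const * \<tau> \<le> moser_const * (4 / c)"
      using \<tau> moser_const_nonneg by (intro mult_left_mono) (auto simp: T_def)
    from mult_left_mono[OF this, of "exp 2"]
    show "exp 2 * (moser_const * \<tau>) \<le> exp 2 * moser_const * (4 / c)" by (simp add: mult.assoc)
    show "exp 4 / c * D \<le> exp 4 / c" using D1 c by (simp add: field_simps)
  qed
  finally show ?thesis .
qed

subsection \<open>Weak gradients of radial functions\<close>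

lemma test_fun_support:
  fixes \<phi> :: "real^'n::finite \<Rightarrow> real"
  assumes "test_fun \<phi>"
  shows "continuous_on UNIV \<phi>" "continuous_on UNIV (partial \<phi> i)"
    "(\<phi> has_derivative frechet_derivative \<phi> (at x)) (at x)"
    "\<exists>R. \<forall>x i. norm x > R \<longrightarrow> \<phi> x = 0 \<and> partial \<phi> i x = 0"
proof -
  have C: "\<And>k. Ck k \<phi>" and comp: "compact (closure {x. \<phi> x \<noteq> 0})"
    using assms by (auto simp: test_fun_def)
  show "continuous_on UNIV \<phi>" using C[of 0] by simp
  show "continuous_on UNIV (partial \<phi> i)" using C[of "Suc 0"] by simp
  show "(\<phi> has_derivative frechet_derivative \<phi> (at x)) (at x)"
    using C[of "Suc 0"] by (simp add: frechet_derivative_works[symmetric])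
  obtain R where R: "\<And>x. x \<in> closure {x. \<phi> x \<noteq> 0} \<Longrightarrow> norm x \<le> R"
    using compact_imp_bounded[OF comp] by (auto simp: bounded_iff)
  have "\<phi> x = 0 \<and> partial \<phi> i x = 0" if "norm x > R" for x i
  proof -
    have x: "x \<in> - closure {x. \<phi> x \<noteq> 0}" using R that by fastforce
    have zero: "\<phi> y = 0" if "y \<in> - closure {x. \<phi> x \<noteq> 0}" for y
      using that closure_subset[of "{x. \<phi> x \<noteq> 0}"] by blast
    have "(\<phi> has_derivative (\<lambda>_. 0)) (at x)"
    proof (rule has_derivative_transform_within_open[OF has_derivative_const _ x])
      show "0 = \<phi> y" if "y \<in> - closure {x. \<phi> x \<noteq> 0}" for y using zero[OF that] by simp
    qed (rule open_Compl[OF closed_closure])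
    then show ?thesis using zero[OF x] partial_eq by fastforce
  qed
  then show "\<exists>R. \<forall>x i. norm x > R \<longrightarrow> \<phi> x = 0 \<and> partial \<phi> i x = 0" by blast
qed

lemma integrable_mult_L2:
  fixes f h :: "'a \<Rightarrow> real"
  assumes "f \<in> borel_measurable M" "h \<in> borel_measurable M"
    and "integrable M (\<lambda>x. (f x)\<^sup>2)" "integrable M (\<lambda>x. (h x)\<^sup>2)"
  shows "integrable M (\<lambda>x. f x * h x)"
proof (rule Bochner_Integration.integrable_bound)
  show "integrable M (\<lambda>x. (f x)\<^sup>2 + (h x)\<^sup>2)" using assms by auto
  have "norm (f x * h x) \<le> norm ((f x)\<^sup>2 + (h x)\<^sup>2)" for x
  proof -
    have "2 * (\<bar>f x\<bar> * \<bar>h x\<bar>) \<le> (f x)\<^sup>2 + (h x)\<^sup>2"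
      using sum_squares_bound[of "\<bar>f x\<bar>" "\<bar>h x\<bar>"] by (simp add: mult.assoc)
    moreover have "0 \<le> \<bar>f x\<bar> * \<bar>h x\<bar>" by simp
    ultimately have "\<bar>f x\<bar> * \<bar>h x\<bar> \<le> (f x)\<^sup>2 + (h x)\<^sup>2" by linarith
    then show ?thesis by (simp add: abs_mult)
  qed
  then show "AE x in M. norm (f x * h x) \<le> norm ((f x)\<^sup>2 + (h x)\<^sup>2)" by simp
  show "(\<lambda>x. f x * h x) \<in> borel_measurable M" using assms(1,2) by measurable
qed

lemma continuous_compact_support_L2:
  fixes h :: "'a::euclidean_space \<Rightarrow> real"
  assumes "continuous_on UNIV h" "\<And>x. norm x > R \<Longrightarrow> h x = 0"
  shows "h \<in> borel_measurable lebesgue" "integrable lebesgue (\<lambda>x. (h x)\<^sup>2)"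
proof -
  have [measurable]: "h \<in> borel_measurable borel" using assms(1) by (rule borel_measurable_continuous_onI)
  then show "h \<in> borel_measurable lebesgue" by (simp add: measurable_completion)
  have "integrable lborel (\<lambda>x. indicator (cball 0 R) x *\<^sub>R (h x)\<^sup>2)"
    by (intro borel_integrable_compact continuous_intros continuous_on_subset[OF assms(1)]) auto
  also have "(\<lambda>x. indicator (cball 0 R) x *\<^sub>R (h x)\<^sup>2) = (\<lambda>x. (h x)\<^sup>2)"
    using assms(2) by (auto simp: indicator_def fun_eq_iff not_le)
  finally show "integrable lebesgue (\<lambda>x. (h x)\<^sup>2)"
    by (simp add: integrable_completion)
qed

text \<open>Summing the weak identities for x_i \<eta>(t) with \<eta> = \<Psi>/t produces the
  divergence 2N (\<eta> + t \<eta>') = 2N \<Psi>'. The dimension 2N makes both terms carry the same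
  factor. Vanishing of \<Psi> near 0 makes the quotient smooth.\<close>

lemma weak_grad_radial_identity:
  fixes u :: "real^'n::finite \<Rightarrow> real"
  assumes card: "CARD('n) = 2 * N" and N: "N > 0"
    and meas: "u \<in> borel_measurable lebesgue" "g \<in> borel_measurable lebesgue" and wg: "weak_grad u g"
    and L2: "integrable lebesgue (\<lambda>x. (u x)\<^sup>2)" "integrable lebesgue (\<lambda>x. (norm (g x))\<^sup>2)"
    and \<Psi>: "\<And>k. Dk k \<Psi>" "\<And>t. (\<Psi> has_real_derivative \<psi> t) (at t)"
    and supp: "a > 0" "\<And>t. t < a \<Longrightarrow> \<Psi> t = 0" "\<And>t. t > b \<Longrightarrow> \<Psi> t = 0"
  shows "2 * real N * (\<integral>x. u x * \<psi> (norm x ^ (2 * N)) \<partial>lebesgue)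
    = - (\<integral>x. (g x \<bullet> x) * (\<Psi> (norm x ^ (2 * N)) / norm x ^ (2 * N)) \<partial>lebesgue)"
    "integrable lebesgue (\<lambda>x. (g x \<bullet> x) * (\<Psi> (norm x ^ (2 * N)) / norm x ^ (2 * N)))"
proof -
  define \<eta> where "\<eta> t = \<Psi> t / t" for t
  have D\<eta>: "Dk k \<eta>" for k
  proof -
    have "Dk k (\<lambda>t. \<Psi> t / (1 * t + 0) ^ 1)"
    proof (rule Dk_divide_power[OF \<Psi>(1) Dk_affine])
      fix t :: real
      show "1 * t + 0 \<noteq> 0 \<or> (\<forall>\<^sub>F y in nhds t. \<Psi> y = 0)"
      proof (cases "t = 0")
        case True
        then have "\<forall>\<^sub>F y in nhds t. y < a"
          using eventually_nhds_in_open[of "{..<a}" t] supp(1) by simp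
        then show ?thesis using supp(2) by (auto elim: eventually_mono)
      qed simp
    qed
    then show ?thesis by (simp add: \<eta>_def[abs_def])
  qed
  obtain \<eta>' where \<eta>': "\<And>t. (\<eta> has_real_derivative \<eta>' t) (at t)"
    using D\<eta>[of "Suc 0"] by auto
  \<comment> \<open>The product t \<eta>(t) equals \<Psi>(t) also at t = 0, where both vanish, so
    uniqueness of derivatives applies.\<close>
  have eq\<psi>: "\<eta> t + t * \<eta>' t = \<psi> t" for t
  proof -
    have "(\<lambda>t. t * \<eta> t) = \<Psi>"
      using supp(2)[OF supp(1)] by (auto simp: \<eta>_def fun_eq_iff)
    moreover have "((\<lambda>t. t * \<eta> t) has_real_derivative 1 * \<eta> t + \<eta>' t * t) (at t)"
      by (rule DERIV_mult[OF DERIV_ident \<eta>'])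
    ultimately show ?thesis using DERIV_unique[OF _ \<Psi>(2)[of t], of "1 * \<eta> t + \<eta>' t * t"] by (simp add: mult.commute)
  qed
  have \<tau>: "norm x ^ (2 * N) = (x \<bullet> x) ^ N" for x :: "real^'n"
    by (simp add: power_mult power2_norm_eq_inner)
  define \<phi> where "\<phi> i x = x $ i * \<eta> ((x \<bullet> x) ^ N)" for i and x :: "real^'n"
  have tf: "test_fun (\<phi> i)" for i
    unfolding \<phi>_def by (rule test_fun_radial_field[OF D\<eta> _ N, of b]) (use supp(3) in \<open>auto simp: \<eta>_def\<close>)
  have \<phi>L2: "\<phi> i \<in> borel_measurable lebesgue" "integrable lebesgue (\<lambda>x. (\<phi> i x)\<^sup>2)"
    "partial (\<phi> i) j \<in> borel_measurable lebesgue" "integrable lebesgue (\<lambda>x. (partial (\<phi> i) j x)\<^sup>2)" for i j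
  proof -
    obtain R where "\<forall>x j. norm x > R \<longrightarrow> \<phi> i x = 0 \<and> partial (\<phi> i) j x = 0"
      using test_fun_support(4)[OF tf] by blast
    then have *: "norm x > R \<Longrightarrow> \<phi> i x = 0" "norm x > R \<Longrightarrow> partial (\<phi> i) j x = 0" for x by auto
    show "\<phi> i \<in> borel_measurable lebesgue" "integrable lebesgue (\<lambda>x. (\<phi> i x)\<^sup>2)"
      using continuous_compact_support_L2[OF test_fun_support(1)[OF tf] *(1)] by auto
    show "partial (\<phi> i) j \<in> borel_measurable lebesgue" "integrable lebesgue (\<lambda>x. (partial (\<phi> i) j x)\<^sup>2)"
      using continuous_compact_support_L2[OF test_fun_support(2)[OF tf] *(2)] by auto
  qed
  have gm: "(\<lambda>x. g x $ i) \<in> borel_measurable lebesgue" for i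
    by (rule measurable_compose[OF meas(2)]) (intro borel_measurable_continuous_onI continuous_intros)
  have gL2: "integrable lebesgue (\<lambda>x. (g x $ i)\<^sup>2)" for i
  proof (rule Bochner_Integration.integrable_bound[OF L2(2)])
    show "(\<lambda>x. (g x $ i)\<^sup>2) \<in> borel_measurable lebesgue" using gm by measurable
    have "(g x $ i)\<^sup>2 \<le> (norm (g x))\<^sup>2" for x
      using component_le_norm_cart[of "g x" i] abs_le_square_iff[of "g x $ i" "norm (g x)"] by simp
    then show "AE x in lebesgue. norm ((g x $ i)\<^sup>2) \<le> norm ((norm (g x))\<^sup>2)" by simp
  qed
  have int1: "integrable lebesgue (\<lambda>x. u x * partial (\<phi> i) i x)" for i
    by (rule integrable_mult_L2[OF meas(1) \<phi>L2(3) L2(1) \<phi>L2(4)])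
  have int2: "integrable lebesgue (\<lambda>x. g x $ i * \<phi> i x)" for i
    by (rule integrable_mult_L2[OF gm \<phi>L2(1) gL2 \<phi>L2(2)])
  have sum1: "(\<Sum>i\<in>UNIV. u x * partial (\<phi> i) i x) = 2 * real N * (u x * \<psi> (norm x ^ (2 * N)))" for x
  proof -
    have "(\<Sum>i\<in>UNIV. partial (\<phi> i) i x)
      = (\<Sum>i\<in>UNIV. \<eta> ((x \<bullet> x) ^ N) + 2 * real N * (x \<bullet> x) ^ (N - 1) * (x $ i)\<^sup>2 * \<eta>' ((x \<bullet> x) ^ N))"
      unfolding \<phi>_def by (intro sum.cong refl partial_radial_field \<eta>')
    also have "\<dots> = 2 * real N * \<eta> ((x \<bullet> x) ^ N)
        + 2 * real N * (x \<bullet> x) ^ (N - 1) * (\<Sum>i\<in>UNIV. (x $ i)\<^sup>2) * \<eta>' ((x \<bullet> x) ^ N)"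
      by (simp add: sum.distrib card sum_distrib_left sum_distrib_right)
    also have "(\<Sum>i\<in>UNIV. (x $ i)\<^sup>2) = x \<bullet> x" by (simp add: inner_vec_def power2_eq_square)
    also have "2 * real N * \<eta> ((x \<bullet> x) ^ N) + 2 * real N * (x \<bullet> x) ^ (N - 1) * (x \<bullet> x) * \<eta>' ((x \<bullet> x) ^ N)
       = 2 * real N * (\<eta> ((x \<bullet> x) ^ N) + (x \<bullet> x) ^ N * \<eta>' ((x \<bullet> x) ^ N))"
      using N by (cases N) (auto simp: algebra_simps)
    finally show ?thesis by (simp add: eq\<psi> \<tau> flip: sum_distrib_left)
  qed
  have sum2: "(\<Sum>i\<in>UNIV. g x $ i * \<phi> i x) = (g x \<bullet> x) * (\<Psi> (norm x ^ (2 * N)) / norm x ^ (2 * N))" for x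
    by (simp add: \<phi>_def \<tau> \<eta>_def inner_vec_def sum_distrib_right sum_divide_distrib mult.assoc)
  have "(\<Sum>i\<in>UNIV. \<integral>x. u x * partial (\<phi> i) i x \<partial>lebesgue) = (\<Sum>i\<in>UNIV. - (\<integral>x. g x $ i * \<phi> i x \<partial>lebesgue))"
    using wg tf by (intro sum.cong refl) (auto simp: weak_grad_def)
  then have "(\<integral>x. (\<Sum>i\<in>UNIV. u x * partial (\<phi> i) i x) \<partial>lebesgue) = - (\<integral>x. (\<Sum>i\<in>UNIV. g x $ i * \<phi> i x) \<partial>lebesgue)"
    using int1 int2 by (simp add: Bochner_Integration.integral_sum sum_negf)
  then show "2 * real N * (\<integral>x. u x * \<psi> (norm x ^ (2 * N)) \<partial>lebesgue)
    = - (\<integral>x. (g x \<bullet> x) * (\<Psi> (norm x ^ (2 * N)) / norm x ^ (2 * N)) \<partial>lebesgue)"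
    unfolding sum1 sum2 by simp
  have "integrable lebesgue (\<lambda>x. (\<Sum>i\<in>UNIV. g x $ i * \<phi> i x))" using int2 by auto
  then show "integrable lebesgue (\<lambda>x. (g x \<bullet> x) * (\<Psi> (norm x ^ (2 * N)) / norm x ^ (2 * N)))"
    unfolding sum2 .
qed

text \<open>Cauchy-Schwarz recovered from Young's inequality by the optimal weight s = sqrt(Q/E). If
  E = 0, the weight Q/P would give P <= P/2 for a positive P.\<close>

lemma square_le_of_weighted_mean:
  fixes P E Q :: real
  assumes "\<And>s. s > 0 \<Longrightarrow> P \<le> (s * E + Q / s) / 2" "0 \<le> P" "0 \<le> E" "0 < Q"
  shows "P\<^sup>2 \<le> E * Q"
proof (cases "E = 0")
  case True
  have "P \<le> 0"
  proof (rule ccontr)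
    assume "\<not> P \<le> 0"
    then have "P > 0" by simp
    from assms(1)[of "Q / P"] this assms show False by (simp add: True)
  qed
  then show ?thesis using assms by simp
next
  case False
  then have E: "E > 0" using assms by simp
  define s where "s = sqrt (Q / E)"
  have s: "s > 0" using E assms by (simp add: s_def)
  have s2: "s * s = Q / E" using E assms by (simp add: s_def)
  have "Q / s = s * E" using s s2 E by (simp add: field_simps)
  then have "P \<le> s * E" using assms(1)[OF s] by (simp only: field_sum_of_halves add_divide_distrib)
  then have "P\<^sup>2 \<le> (s * E)\<^sup>2" using assms by (intro power_mono) auto
  also have "\<dots> = E * Q" using s2 E by (simp add: power2_eq_square field_simps)
  finally show ?thesis .
qed

text \<open>The half-open interval makes adjacent shells disjoint and the energy continuous from the
  right in \<open>b\<close>.\<close>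

definition shell_energy :: "nat \<Rightarrow> (real^'n \<Rightarrow> real^'n) \<Rightarrow> real \<Rightarrow> real \<Rightarrow> real" where
  "shell_energy N g a b =
     (\<integral>x. indicator {a<..b} (norm x ^ (2 * N)) * (norm (g x) / norm x ^ (N - 1))\<^sup>2 \<partial>lebesgue)"

text \<open>In the variable t the measure dx/t becomes a constant times dt/t. The resulting
  logarithm is the second factor in the Cauchy-Schwarz estimate on a shell.\<close>

lemma integrable_inverse_shell:
  fixes a b :: real
  assumes "0 < a" "a < b"
  defines "f \<equiv> (\<lambda>x::'a::euclidean_space. indicator {a..b} (norm x ^ DIM('a)) * (1 / norm x ^ DIM('a)))"
  shows "integrable lebesgue f" "(\<integral>x. f x \<partial>lebesgue) = unit_ball_vol DIM('a) * ln (b / a)"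
proof -
  have [measurable]: "f \<in> borel_measurable lborel" unfolding f_def by measurable
  have nn: "f x \<ge> 0" for x by (simp add: f_def)
  have "(\<integral>\<^sup>+ x. ennreal (f x) \<partial>lborel)
    = ennreal (unit_ball_vol DIM('a)) * (\<integral>\<^sup>+ t. ennreal (indicator {a..b} t * (1 / t)) * indicator {0<..} t \<partial>lborel)"
    unfolding f_def by (subst nn_integral_norm_power[symmetric]) auto
  also have "(\<integral>\<^sup>+ t. ennreal (indicator {a..b} t * (1 / t)) * indicator {0<..} t \<partial>lborel)
    = (\<integral>\<^sup>+ t. ennreal (1 / t) * indicator {a..b} t \<partial>lborel)"
    using assms by (intro nn_integral_cong) (auto simp: indicator_def)
  also have "\<dots> = ennreal (ln (b / a))" by (rule nn_integral_inverse_Icc) (use assms in auto)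
  finally have *: "(\<integral>\<^sup>+ x. ennreal (f x) \<partial>lborel) = ennreal (unit_ball_vol DIM('a) * ln (b / a))"
    using assms by (simp add: ennreal_mult)
  have "has_bochner_integral lborel f (unit_ball_vol DIM('a) * ln (b / a))"
    by (rule has_bochner_integral_nn_integral) (use nn * assms in auto)
  then show "integrable lebesgue f" "(\<integral>x. f x \<partial>lebesgue) = unit_ball_vol DIM('a) * ln (b / a)"
    by (auto simp: has_bochner_integral_iff integrable_completion integral_completion)
qed

lemma shell_energy_integrable:
  fixes g :: "real^'n::finite \<Rightarrow> real^'n"
  assumes "g \<in> borel_measurable lebesgue" "integrable lebesgue (\<lambda>x. (norm (g x) / norm x ^ (N - 1))\<^sup>2)"
  shows "integrable lebesgue (\<lambda>x. indicator {a<..b} (norm x ^ (2 * N)) * (norm (g x) / norm x ^ (N - 1))\<^sup>2)"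
proof -
  have [measurable]: "(\<lambda>x::real^'n. norm x ^ (2 * N)) \<in> borel_measurable lebesgue"
    by (intro measurable_completion) measurable
  have [measurable]: "(\<lambda>x. (norm (g x) / norm x ^ (N - 1))\<^sup>2) \<in> borel_measurable lebesgue"
    using assms(2) by (rule borel_measurable_integrable)
  show ?thesis
    by (rule Bochner_Integration.integrable_bound[OF assms(2)]) (measurable, auto simp: indicator_def)
qed

text \<open>By the radial identity the left side is an integral of g . x against \<Psi>(t)/t;
  Cauchy-Schwarz on the shell bounds it by the energy times the integral of 1/t. The support of
  \<Psi> confines both to a < t <= b.\<close>

lemma shell_bound:
  fixes u :: "real^'n::finite \<Rightarrow> real"
  assumes card: "CARD('n) = 2 * N" and N: "N > 0"
    and meas: "u \<in> borel_measurable lebesgue" "g \<in> borel_measurable lebesgue" and wg: "weak_grad u g"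
    and L2: "integrable lebesgue (\<lambda>x. (u x)\<^sup>2)" "integrable lebesgue (\<lambda>x. (norm (g x))\<^sup>2)"
      "integrable lebesgue (\<lambda>x. (norm (g x) / norm x ^ (N - 1))\<^sup>2)"
    and \<Psi>: "\<And>k. Dk k \<Psi>" "\<And>t. (\<Psi> has_real_derivative \<psi> t) (at t)"
    and supp: "a > 0" "a < b" "\<And>t. t \<le> a \<Longrightarrow> \<Psi> t = 0" "\<And>t. t > b \<Longrightarrow> \<Psi> t = 0"
    and K: "\<And>t. \<bar>\<Psi> t\<bar> \<le> K"
  shows "(2 * real N * \<bar>\<integral>x. u x * \<psi> (norm x ^ (2 * N)) \<partial>lebesgue\<bar>)\<^sup>2
    \<le> K\<^sup>2 * (shell_energy N g a b * (unit_ball_vol (2 * N) * ln (b / a)))"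
proof -
  let ?\<beta> = "unit_ball_vol (2 * N)"
  let ?Q = "?\<beta> * ln (b / a)"
  let ?E = "shell_energy N g a b"
  define P where "P = 2 * real N * \<bar>\<integral>x. u x * \<psi> (norm x ^ (2 * N)) \<partial>lebesgue\<bar>"
  define F where "F x = (g x \<bullet> x) * (\<Psi> (norm x ^ (2 * N)) / norm x ^ (2 * N))" for x
  define q where "q x = indicator {a..b} (norm x ^ (2 * N)) * (1 / norm x ^ (2 * N))" for x :: "real^'n"
  define e where "e x = indicator {a<..b} (norm x ^ (2 * N)) * (norm (g x) / norm x ^ (N - 1))\<^sup>2" for x
  have K0: "K \<ge> 0" using K[of 0] by linarith
  have id: "2 * real N * (\<integral>x. u x * \<psi> (norm x ^ (2 * N)) \<partial>lebesgue) = - (\<integral>x. F x \<partial>lebesgue)"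
    and intF: "integrable lebesgue F"
    unfolding F_def[abs_def]
    using weak_grad_radial_identity[OF card N meas wg L2(1,2) \<Psi> supp(1) _ supp(4)] supp(3) by auto
  have PF: "P = \<bar>\<integral>x. F x \<partial>lebesgue\<bar>"
    using arg_cong[OF id, of abs] N by (simp add: P_def abs_mult)
  have intq: "integrable lebesgue q" "(\<integral>x. q x \<partial>lebesgue) = ?Q"
    unfolding q_def[abs_def]
    using integrable_inverse_shell[where 'a = "real^'n", OF supp(1,2)] by (simp_all add: card)
  have inte: "integrable lebesgue e" "(\<integral>x. e x \<partial>lebesgue) = ?E"
    unfolding e_def[abs_def] shell_energy_def using shell_energy_integrable[OF meas(2) L2(3)] by auto
  have pt: "\<bar>F x\<bar> \<le> K * (s / 2 * e x + 1 / (2 * s) * q x)" if s: "s > 0" for s x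
  proof (cases "norm x ^ (2 * N) \<in> {a<..b}")
    case False
    then have "\<Psi> (norm x ^ (2 * N)) = 0" using supp by force
    moreover have "0 \<le> q x" "0 \<le> e x" by (auto simp: q_def e_def)
    ultimately show ?thesis using s K0 by (simp add: F_def)
  next
    case True
    define r where "r = norm x"
    have r: "r > 0"
    proof -
      have "r ^ (2 * N) > 0" using True supp(1) by (simp add: r_def)
      then have "r \<noteq> 0" using N by (auto simp: power_0_left)
      then show ?thesis by (simp add: r_def)
    qed
    define y where "y = norm (g x) / r ^ (N - 1)"
    \<comment> \<open>The splitting of exponents |x|^(1-2N) = |x|^(-(N-1)) |x|^(-N): the first
      factor is the weight in the norm, the second squares to 1/t.\<close>
    have ry: "norm (g x) * r / r ^ (2 * N) = y * (1 / r ^ N)"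
    proof -
      have "r ^ (2 * N) = r ^ (N - 1) * r * r ^ N"
        using N by (simp add: mult_2 power_add flip: power_Suc2)
      then show ?thesis using r by (simp add: y_def)
    qed
    have "\<bar>F x\<bar> = \<bar>g x \<bullet> x\<bar> * \<bar>\<Psi> (norm x ^ (2 * N))\<bar> / r ^ (2 * N)"
      using r by (simp add: F_def abs_mult r_def)
    also have "\<dots> \<le> (norm (g x) * r) * K / r ^ (2 * N)"
      using r K K0 Cauchy_Schwarz_ineq2[of "g x" x]
      by (intro divide_right_mono mult_mono) (auto simp: r_def)
    also have "\<dots> = K * (y * (1 / r ^ N))" using arg_cong[OF ry, of "(*) K"] by (simp add: mult_ac)
    also have "y * (1 / r ^ N) \<le> s / 2 * y\<^sup>2 + 1 / (2 * s) * (1 / r ^ N)\<^sup>2"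
    proof -
      have "0 \<le> (s * y - 1 / r ^ N)\<^sup>2" by simp
      then have "2 * s * (y * (1 / r ^ N)) \<le> s\<^sup>2 * y\<^sup>2 + (1 / r ^ N)\<^sup>2"
        by (simp add: power2_eq_square algebra_simps)
      also have "\<dots> = 2 * s * (s / 2 * y\<^sup>2 + 1 / (2 * s) * (1 / r ^ N)\<^sup>2)"
        using s by (simp add: power2_eq_square distrib_left)
      finally show ?thesis using s by (subst (asm) mult_le_cancel_left_pos) auto
    qed
    also have "s / 2 * y\<^sup>2 + 1 / (2 * s) * (1 / r ^ N)\<^sup>2 = s / 2 * e x + 1 / (2 * s) * q x"
      using True by (simp add: e_def q_def y_def r_def power_divide power_mult mult.commute flip: power_mult)
    finally show ?thesis using K0 by (simp add: mult_left_mono)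
  qed
  \<comment> \<open>The factor K is attached to both quantities so that the optimisation over s
    gives K^2. It needs a positive second quantity, so K = 0 is handled apart.\<close>
  have "P\<^sup>2 \<le> (K * ?E) * (K * ?Q)" if "K > 0"
  proof (rule square_le_of_weighted_mean)
    fix s :: real assume s: "s > 0"
    have "P \<le> (\<integral>x. \<bar>F x\<bar> \<partial>lebesgue)" unfolding PF by (rule integral_abs_bound)
    also have "\<dots> \<le> (\<integral>x. K * (s / 2 * e x + 1 / (2 * s) * q x) \<partial>lebesgue)"
      by (rule integral_mono) (use intF intq inte pt[OF s] in auto)
    also have "\<dots> = K * (s / 2 * ?E + 1 / (2 * s) * ?Q)"
      using intq inte by simp
    also have "\<dots> = (s * (K * ?E) + (K * ?Q) / s) / 2" by (simp add: algebra_simps add_divide_distrib)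
    finally show "P \<le> (s * (K * ?E) + (K * ?Q) / s) / 2" .
  next
    show "0 \<le> P" by (simp add: P_def)
    show "0 \<le> K * ?E" using K0 by (auto simp: shell_energy_def intro!: mult_nonneg_nonneg integral_nonneg_AE)
    show "0 < K * ?Q" using that supp by (intro mult_pos_pos) auto
  qed
  moreover have "P\<^sup>2 = 0" if "K = 0"
  proof -
    have "F x = 0" for x using pt[of 1 x] that by simp
    then show ?thesis by (simp add: PF)
  qed
  ultimately show ?thesis using K0 unfolding P_def[symmetric]
    by (cases "K = 0") (auto simp: power2_eq_square mult_ac)
qed

section \<open>The profile of a radial Sobolev function and its oscillation\<close>

locale radial_sobolev =
  fixes u :: "real^'n::finite \<Rightarrow> real" and g :: "real^'n \<Rightarrow> real^'n" and N :: nat and v :: "real \<Rightarrow> real"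
  assumes card: "CARD('n) = 2 * N" and N: "N > 0"
    and meas_u: "u \<in> borel_measurable lebesgue" and meas_g: "g \<in> borel_measurable lebesgue"
    and weak_grad: "weak_grad u g"
    and L2_u: "integrable lebesgue (\<lambda>x. (u x)\<^sup>2)"
    and L2_g: "integrable lebesgue (\<lambda>x. (norm (g x))\<^sup>2)"
    and L2_weighted: "integrable lebesgue (\<lambda>x. (norm (g x) / norm x ^ (N - 1))\<^sup>2)"
    and meas_v[measurable]: "v \<in> borel_measurable borel"
    and profile: "AE x in lborel. u x = v (norm x ^ (2 * N))"
begin

abbreviation "\<beta> \<equiv> unit_ball_vol (2 * real N)"
abbreviation "energy \<equiv> shell_energy N g"

lemma \<beta>_pos: "\<beta> > 0" by simp

text \<open>\<open>u\<close> is only Lebesgue measurable, so the passage to the half line goes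
  through the Borel profile \<open>v\<close>; \<beta> is the density of t = |x|^(2N).\<close>

lemma nn_integral_profile:
  assumes [measurable]: "f \<in> borel_measurable borel"
  shows "(\<integral>\<^sup>+ x. f (u x) \<partial>lebesgue) = ennreal \<beta> * (\<integral>\<^sup>+ t. f (v t) * indicator {0<..} t \<partial>lborel)"
proof -
  have "(\<integral>\<^sup>+ x. f (u x) \<partial>lebesgue) = (\<integral>\<^sup>+ x. f (v (norm (x::real^'n) ^ DIM(real^'n))) \<partial>lborel)"
    unfolding nn_integral_completion
    by (rule nn_integral_cong_AE) (use profile in \<open>auto simp: card elim: eventually_mono\<close>)
  also have "\<dots> = ennreal \<beta> * (\<integral>\<^sup>+ t. f (v t) * indicator {0<..} t \<partial>lborel)"
    by (subst nn_integral_norm_power) (auto simp: card)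
  finally show ?thesis .
qed

lemma integral_profile:
  assumes [measurable]: "f \<in> borel_measurable borel"
  shows "(\<integral>x. u x * f (norm x ^ (2 * N)) \<partial>lebesgue) = \<beta> * (\<integral> t. v t * f t * indicator {0<..} t \<partial>lborel)"
proof -
  have "(\<integral>x. u x * f (norm x ^ (2 * N)) \<partial>lebesgue)
    = (\<integral>x. v (norm (x::real^'n) ^ (2 * N)) * f (norm x ^ (2 * N)) \<partial>lebesgue)"
  proof (rule integral_cong_AE)
    have [measurable]: "(\<lambda>x::real^'n. f (norm x ^ (2 * N))) \<in> borel_measurable lebesgue"
      by (intro measurable_completion) measurable
    show "(\<lambda>x. u x * f (norm x ^ (2 * N))) \<in> borel_measurable lebesgue"
      using meas_u by measurable
    show "(\<lambda>x::real^'n. v (norm x ^ (2 * N)) * f (norm x ^ (2 * N))) \<in> borel_measurable lebesgue"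
      by (intro measurable_completion) measurable
    show "AE x in lebesgue. u x * f (norm x ^ (2 * N)) = v (norm x ^ (2 * N)) * f (norm x ^ (2 * N))"
      by (rule AE_completion) (use profile in \<open>auto elim: eventually_mono\<close>)
  qed
  also have "\<dots> = (\<integral>x. v (norm (x::real^'n) ^ (2 * N)) * f (norm x ^ (2 * N)) \<partial>lborel)"
    by (rule integral_completion) measurable
  also have "\<dots> = \<beta> * (\<integral> t. v t * f t * indicator {0<..} t \<partial>lborel)"
    using integral_norm_power[where 'a = "real^'n" and f = "\<lambda>t. v t * f t"] by (simp add: card)
  finally show ?thesis .
qed

lemma profile_L2: "integrable lborel (\<lambda>t. (v t * indicator {0<..} t)\<^sup>2)"
proof (rule integrableI_bounded)
  have "(\<integral>\<^sup>+ x. ennreal ((u x)\<^sup>2) \<partial>lebesgue) < \<infinity>"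
    using L2_u by (simp add: integrable_iff_bounded)
  then have "ennreal \<beta> * (\<integral>\<^sup>+ t. ennreal ((v t)\<^sup>2) * indicator {0<..} t \<partial>lborel) < \<infinity>"
    by (subst (asm) nn_integral_profile[of "\<lambda>y. ennreal (y\<^sup>2)"]) auto
  then have "(\<integral>\<^sup>+ t. ennreal ((v t)\<^sup>2) * indicator {0<..} t \<partial>lborel) < \<infinity>"
    using \<beta>_pos by (auto simp: ennreal_mult_less_top)
  also have "(\<integral>\<^sup>+ t. ennreal ((v t)\<^sup>2) * indicator {0<..} t \<partial>lborel)
    = (\<integral>\<^sup>+ t. ennreal (norm ((v t * indicator {0<..} t)\<^sup>2)) \<partial>lborel)"
    by (intro nn_integral_cong) (auto simp: indicator_def)
  finally show "(\<integral>\<^sup>+ t. ennreal (norm ((v t * indicator {0<..} t)\<^sup>2)) \<partial>lborel) < \<infinity>" .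
qed measurable

lemma profile_integrable:
  "integrable lborel (\<lambda>t. v t * indicator {0<..} t * indicator {a..b} t)"
proof (rule integrable_mult_L2[OF _ _ profile_L2])
  have "integrable lborel (indicator {a..b} :: real \<Rightarrow> real)"
    by (rule integrable_real_indicator) (auto simp: emeasure_lborel_Icc_eq)
  also have "(indicator {a..b} :: real \<Rightarrow> real) = (\<lambda>t. (indicator {a..b} t)\<^sup>2)"
    by (auto simp: indicator_def)
  finally show "integrable lborel (\<lambda>t. (indicator {a..b} t :: real)\<^sup>2)" .
qed measurable

text \<open>The ideal test profile is the trapezoid of height 1 with slope 1/h after a and -1/h
  after b; integrating v against its slope gives the difference of two averages. The smooth
  approximations need room past b+h to become linear, hence the endpoint b+2h.\<close>

lemma average_bound:
  assumes ab: "0 < a" "a < b" and h: "h > 0"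
  shows "(2 * real N * \<beta> * \<bar>(\<integral>t. v t * indicator {a<..a + h} t \<partial>lborel) / h
      - (\<integral>t. v t * indicator {b<..b + h} t \<partial>lborel) / h\<bar>)\<^sup>2
    \<le> energy a (b + 2 * h) * (\<beta> * ln ((b + 2 * h) / a))"
proof -
  obtain q B where q: "\<And>x. (smooth_ramp has_real_derivative q x) (at x)"
    "continuous_on UNIV q" "\<And>x. x \<le> 0 \<Longrightarrow> q x = 0" "\<And>x. x \<ge> 1 \<Longrightarrow> q x = 1" "\<And>x. \<bar>q x\<bar> \<le> B"
    using smooth_ramp_derivative by blast
  have [measurable]: "q \<in> borel_measurable borel" using q(2) by (rule borel_measurable_continuous_onI)
  \<comment> \<open>Four ramps with corners a, a+h, b, b+h, rounded at scale 1/n. Once nh >= 1 all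
    of them are linear beyond b+2h and cancel.\<close>
  define \<Psi> where "\<Psi> n t = (smooth_ramp (real n * t + - (real n * a)) + (- 1) * smooth_ramp (real n * t + - (real n * (a + h)))
      + (- 1) * smooth_ramp (real n * t + - (real n * b)) + smooth_ramp (real n * t + - (real n * (b + h)))) * (1 / (real n * h))" for n :: nat and t
  define \<psi> where "\<psi> n t = (q (real n * t + - (real n * a)) - q (real n * t + - (real n * (a + h)))
      - q (real n * t + - (real n * b)) + q (real n * t + - (real n * (b + h)))) / h" for n :: nat and t
  define I where "I n = (\<integral> t. v t * \<psi> n t * indicator {0<..} t \<partial>lborel)" for n
  define J where "J = (\<integral>t. v t * indicator {a<..a + h} t \<partial>lborel) / h - (\<integral>t. v t * indicator {b<..b + h} t \<partial>lborel) / h"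
  let ?R = "energy a (b + 2 * h) * (\<beta> * ln ((b + 2 * h) / a))"
  have [measurable]: "\<psi> n \<in> borel_measurable borel" for n unfolding \<psi>_def by measurable
  have bound: "(2 * real N * \<beta> * \<bar>I n\<bar>)\<^sup>2 \<le> (1 + 4 / (real n * h))\<^sup>2 * ?R" if n: "real n * h \<ge> 1" for n
  proof -
    have n0: "real n > 0" using n h by (cases "n = 0") auto
    have "(2 * real N * \<bar>\<integral>x. u x * \<psi> n (norm x ^ (2 * N)) \<partial>lebesgue\<bar>)\<^sup>2
      \<le> (1 + 4 / (real n * h))\<^sup>2 * (energy a (b + 2 * h) * (unit_ball_vol (2 * N) * ln ((b + 2 * h) / a)))"
    proof (rule shell_bound[OF card N meas_u meas_g weak_grad L2_u L2_g L2_weighted, where \<Psi> = "\<Psi> n"])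
      show "Dk k (\<Psi> n)" for k
        unfolding \<Psi>_def by (intro Dk_mult Dk_add Dk_const Dk_compose_affine[OF Dk_smooth_ramp])
      have d: "((\<lambda>t. smooth_ramp (real n * t + c)) has_real_derivative q (real n * t + c) * real n) (at t)" for c t
        by (rule DERIV_chain2[where f = smooth_ramp and g = "\<lambda>t. real n * t + c", OF q(1)])
           (auto intro!: derivative_eq_intros)
      show "(\<Psi> n has_real_derivative \<psi> n t) (at t)" for t
        unfolding \<Psi>_def
        by (rule DERIV_cong[OF DERIV_cmult_right[OF DERIV_add[OF DERIV_add[OF DERIV_add[OF d
            DERIV_cmult[OF d]] DERIV_cmult[OF d]] d]]])
           (use n0 h in \<open>simp add: \<psi>_def field_simps\<close>)
      show "\<Psi> n t = 0" if "t \<le> a" for t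
      proof -
        have "real n * t \<le> real n * a" "real n * t \<le> real n * (a + h)"
          "real n * t \<le> real n * b" "real n * t \<le> real n * (b + h)"
          using that ab h by (auto intro!: mult_left_mono)
        then show ?thesis by (simp add: \<Psi>_def smooth_ramp_0)
      qed
      show "\<Psi> n t = 0" if "t > b + 2 * h" for t
      proof -
        have "real n * (t - a) \<ge> real n * h" "real n * (t - (a + h)) \<ge> real n * h"
          "real n * (t - b) \<ge> real n * h" "real n * (t - (b + h)) \<ge> real n * h"
          using that ab h by (auto intro!: mult_left_mono)
        then have "real n * t + - (real n * a) \<ge> 1" "real n * t + - (real n * (a + h)) \<ge> 1"
          "real n * t + - (real n * b) \<ge> 1" "real n * t + - (real n * (b + h)) \<ge> 1"
          using n by (simp_all add: algebra_simps)
        then have *: "smooth_ramp (real n * t + - (real n * a)) = real n * t + - (real n * a)"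
          "smooth_ramp (real n * t + - (real n * (a + h))) = real n * t + - (real n * (a + h))"
          "smooth_ramp (real n * t + - (real n * b)) = real n * t + - (real n * b)"
          "smooth_ramp (real n * t + - (real n * (b + h))) = real n * t + - (real n * (b + h))"
          by (simp_all only: smooth_ramp_id)
        show ?thesis unfolding \<Psi>_def * by (simp add: algebra_simps)
      qed
      show "\<bar>\<Psi> n t\<bar> \<le> 1 + 4 / (real n * h)" for t
      proof -
        let ?r = "\<lambda>c. smooth_ramp (real n * t + - (real n * c))"
        let ?m = "\<lambda>c. max 0 (real n * t + - (real n * c))"
        have r: "\<bar>?r c - ?m c\<bar> \<le> 1" for c by (rule smooth_ramp_approx)
        \<comment> \<open>Each pair of exact ramps lies in [0, nh], so their difference has modulus
          at most nh even if the two flanks overlap. The four rounding errors add at most 4.\<close>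
        have "0 \<le> ?m c - ?m (c + h)" "?m c - ?m (c + h) \<le> real n * h" for c
          using n by (auto simp: algebra_simps max_def)
        from this[of a] this[of b]
        have "\<bar>?r a + (- 1) * ?r (a + h) + (- 1) * ?r b + ?r (b + h)\<bar> \<le> real n * h + 4"
          using r[of a] r[of "a + h"] r[of b] r[of "b + h"] by linarith
        then have "\<bar>?r a + (- 1) * ?r (a + h) + (- 1) * ?r b + ?r (b + h)\<bar> * (1 / (real n * h)) \<le> (real n * h + 4) * (1 / (real n * h))"
          using n by (intro mult_right_mono) auto
        also have "\<dots> = 1 + 4 / (real n * h)" using n0 h by (simp add: field_simps)
        finally show ?thesis using n unfolding \<Psi>_def abs_mult by simp
      qed
    qed (use ab h in auto)
    then show ?thesis unfolding integral_profile[OF \<open>\<psi> n \<in> borel_measurable borel\<close>] I_def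
      by (simp add: abs_mult mult_ac)
  qed
  have lim: "I \<longlonglongrightarrow> J"
  proof -
    define s where "s t = (indicator {a<..a + h} t - indicator {b<..b + h} t) / h" for t :: real
    have s_lim: "(\<lambda>n. \<psi> n t) \<longlonglongrightarrow> s t" for t
    proof -
      \<comment> \<open>At t = c the value is \<open>q 0 = 0\<close>, which is why the limiting
        indicators are open on the left.\<close>
      have q_lim: "(\<lambda>n. q (real n * t + - (real n * c))) \<longlonglongrightarrow> (if t > c then 1 else 0)" for c
      proof (cases "t > c")
        case True
        then have tc: "t - c > 0" by simp
        obtain n0 :: nat where n0: "1 / (t - c) < real n0" using reals_Archimedean2 by blast
        have "\<forall>\<^sub>F n in sequentially. 1 = q (real n * t + - (real n * c))"
          using eventually_ge_at_top[of n0]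
        proof eventually_elim
          case (elim n)
          then have "1 / (t - c) \<le> real n" using n0 by simp
          then have "1 \<le> real n * (t - c)" using tc by (simp add: field_simps)
          then show ?case using q(4) by (simp add: algebra_simps)
        qed
        then show ?thesis using True by (auto intro: Lim_transform_eventually[OF tendsto_const])
      next
        case False
        have "q (real n * t + - (real n * c)) = 0" for n
        proof (rule q(3))
          have "real n * t \<le> real n * c" using False by (intro mult_left_mono) auto
          then show "real n * t + - (real n * c) \<le> 0" by simp
        qed
        then show ?thesis using False by simp
      qed
      have "(\<lambda>n. \<psi> n t) \<longlonglongrightarrow> ((if t > a then 1 else 0) - (if t > a + h then 1 else 0)
          - (if t > b then 1 else 0) + (if t > b + h then 1 else 0)) / h"
        unfolding \<psi>_def using h by (intro tendsto_intros q_lim) auto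
      also have "((if t > a then 1 else 0) - (if t > a + h then 1 else 0)
          - (if t > b then 1 else 0) + (if t > b + h then 1 else 0)) / h = s t"
        using h ab by (auto simp: s_def indicator_def)
      finally show ?thesis .
    qed
    \<comment> \<open>Four slopes bounded by B, divided by h, on the interval outside which the
      slopes cancel; valid from the index \<open>n0\<close> with n0 h > 1, hence the shifted
      sequence.\<close>
    define w where "w t = \<bar>v t * indicator {0<..} t * indicator {a..b + 2 * h} t\<bar> * (4 * B / h)" for t
    have int_w: "integrable lborel w"
      unfolding w_def by (intro integrable_mult_left integrable_abs profile_integrable)
    obtain n0 :: nat where n0: "1 / h < real n0" using reals_Archimedean2 by blast
    have "(\<lambda>n. \<integral> t. v t * \<psi> (n + n0) t * indicator {0<..} t \<partial>lborel) \<longlonglongrightarrow> (\<integral> t. v t * s t * indicator {0<..} t \<partial>lborel)"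
    proof (rule integral_dominated_convergence[OF _ _ int_w])
      have "(\<lambda>n. v t * \<psi> (n + n0) t * indicator {0<..} t) \<longlonglongrightarrow> v t * s t * indicator {0<..} t" for t
        using s_lim[THEN LIMSEQ_ignore_initial_segment] by (intro tendsto_intros)
      then show "AE t in lborel. (\<lambda>n. v t * \<psi> (n + n0) t * indicator {0<..} t) \<longlonglongrightarrow> v t * s t * indicator {0<..} t"
        by simp
      have "\<bar>v t * \<psi> (n + n0) t * indicator {0<..} t\<bar> \<le> w t" for n t
      proof -
        let ?n = "n + n0"
        have "1 / h \<le> real ?n" using n0 by simp
        then have nh: "1 \<le> real ?n * h" using h by (simp add: field_simps)
        have "\<bar>\<psi> ?n t\<bar> \<le> indicator {a..b + 2 * h} t * (4 * B / h)"
        proof -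
          consider "t < a" | "a \<le> t" "t \<le> b + 2 * h" | "t > b + 2 * h" by linarith
          then show ?thesis
          proof cases
            case 1
            have "real ?n * t \<le> real ?n * a" "real ?n * t \<le> real ?n * (a + h)"
              "real ?n * t \<le> real ?n * b" "real ?n * t \<le> real ?n * (b + h)"
              using 1 ab h by (auto intro!: mult_left_mono)
            then show ?thesis using 1 unfolding \<psi>_def by (simp add: q(3) del: of_nat_add)
          next
            case 2
            have "\<bar>y1 - y2 - y3 + y4\<bar> / \<bar>h\<bar> \<le> 4 * B / h"
              if "\<bar>y1\<bar> \<le> B" "\<bar>y2\<bar> \<le> B" "\<bar>y3\<bar> \<le> B" "\<bar>y4\<bar> \<le> B" for y1 y2 y3 y4
              using that h by (intro frac_le) auto
            then have "\<bar>\<psi> ?n t\<bar> \<le> 4 * B / h" unfolding \<psi>_def abs_divide using q(5) by blast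
            then show ?thesis using 2 by simp
          next
            case 3
            have "real ?n * (t - a) \<ge> real ?n * h" "real ?n * (t - (a + h)) \<ge> real ?n * h"
              "real ?n * (t - b) \<ge> real ?n * h" "real ?n * (t - (b + h)) \<ge> real ?n * h"
              using 3 ab h by (auto intro!: mult_left_mono)
            then have "real ?n * t + - (real ?n * a) \<ge> 1" "real ?n * t + - (real ?n * (a + h)) \<ge> 1"
              "real ?n * t + - (real ?n * b) \<ge> 1" "real ?n * t + - (real ?n * (b + h)) \<ge> 1"
              using nh by (simp_all add: algebra_simps)
            then have "\<psi> ?n t = (1 - 1 - 1 + 1) / h" unfolding \<psi>_def by (simp only: q(4))
            then show ?thesis using 3 by simp
          qed
        qed
        from mult_left_mono[OF this, of "\<bar>v t * indicator {0<..} t\<bar>"]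
        show ?thesis by (simp add: w_def abs_mult mult_ac)
      qed
      then show "\<And>n. AE t in lborel. norm (v t * \<psi> (n + n0) t * indicator {0<..} t) \<le> w t" by simp
    qed (unfold s_def, measurable)
    then have "(\<lambda>n. I (n + n0)) \<longlonglongrightarrow> (\<integral> t. v t * s t * indicator {0<..} t \<partial>lborel)"
      unfolding I_def .
    then have "I \<longlonglongrightarrow> (\<integral> t. v t * s t * indicator {0<..} t \<partial>lborel)"
      by (rule LIMSEQ_offset)
    also have "(\<integral> t. v t * s t * indicator {0<..} t \<partial>lborel) = J"
    proof -
      have int: "integrable lborel (\<lambda>t. v t * indicator {c<..c + h} t)" if "c > 0" for c
      proof (rule Bochner_Integration.integrable_bound[OF profile_integrable[of c "c + h"]])
        show "AE t in lborel. norm (v t * indicator {c<..c + h} t) \<le> norm (v t * indicator {0<..} t * indicator {c..c + h} t)"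
          using that by (auto simp: indicator_def)
      qed measurable
      have "(\<integral> t. v t * s t * indicator {0<..} t \<partial>lborel)
        = (\<integral> t. v t * indicator {a<..a + h} t / h - v t * indicator {b<..b + h} t / h \<partial>lborel)"
        using ab h by (intro Bochner_Integration.integral_cong) (auto simp: s_def indicator_def)
      also have "\<dots> = J" unfolding J_def using int ab by simp
      finally show ?thesis .
    qed
    finally show ?thesis .
  qed
  have "(\<lambda>n. (2 * real N * \<beta> * \<bar>I n\<bar>)\<^sup>2) \<longlonglongrightarrow> (2 * real N * \<beta> * \<bar>J\<bar>)\<^sup>2"
    by (intro tendsto_intros lim)
  moreover have "(\<lambda>n. (1 + 4 / (real n * h))\<^sup>2 * ?R) \<longlonglongrightarrow> (1 + 0)\<^sup>2 * ?R"
  proof (intro tendsto_intros)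
    have "(\<lambda>n. (4 / h) * inverse (real n)) \<longlonglongrightarrow> (4 / h) * 0"
      by (intro tendsto_intros lim_inverse_n)
    then show "(\<lambda>n. 4 / (real n * h)) \<longlonglongrightarrow> 0" by (simp add: field_simps)
  qed
  moreover have "\<forall>\<^sub>F n in sequentially. (2 * real N * \<beta> * \<bar>I n\<bar>)\<^sup>2 \<le> (1 + 4 / (real n * h))\<^sup>2 * ?R"
  proof -
    obtain n0 :: nat where n0: "1 / h < real n0" using reals_Archimedean2 by blast
    show ?thesis
      using eventually_ge_at_top[of n0]
    proof eventually_elim
      case (elim n)
      then have "1 / h \<le> real n" using n0 by simp
      then show ?case using h by (intro bound) (simp add: field_simps)
    qed
  qed
  ultimately have "(2 * real N * \<beta> * \<bar>J\<bar>)\<^sup>2 \<le> (1 + 0)\<^sup>2 * ?R"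
    by (intro tendsto_le[OF sequentially_bot]) auto
  then show ?thesis by (simp add: J_def)
qed

lemma shell_energy_nonneg: "0 \<le> energy a b"
  by (auto simp: shell_energy_def intro!: integral_nonneg_AE)

lemma shell_energy_add_le:
  assumes "a < b" "b < c"
  shows "energy a b + energy b c \<le> (\<integral>x. (norm (g x) / norm x ^ (N - 1))\<^sup>2 \<partial>lebesgue)"
proof -
  note int = shell_energy_integrable[OF meas_g L2_weighted]
  have "energy a b + energy b c = (\<integral>x. indicator {a<..b} (norm x ^ (2 * N)) * (norm (g x) / norm x ^ (N - 1))\<^sup>2
     + indicator {b<..c} (norm x ^ (2 * N)) * (norm (g x) / norm x ^ (N - 1))\<^sup>2 \<partial>lebesgue)"
    unfolding shell_energy_def by (rule Bochner_Integration.integral_add[OF int int, symmetric])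
  also have "\<dots> \<le> (\<integral>x. (norm (g x) / norm x ^ (N - 1))\<^sup>2 \<partial>lebesgue)"
    by (rule integral_mono[OF Bochner_Integration.integrable_add[OF int int] L2_weighted])
       (use assms in \<open>auto simp: indicator_def\<close>)
  finally show ?thesis .
qed

lemma shell_energy_le: "energy a b \<le> (\<integral>x. (norm (g x) / norm x ^ (N - 1))\<^sup>2 \<partial>lebesgue)"
  unfolding shell_energy_def
  by (rule integral_mono[OF shell_energy_integrable[OF meas_g L2_weighted] L2_weighted])
     (auto simp: indicator_def)

text \<open>Indicators of (a, b+h] decrease to that of (a, b] as h tends to 0 through positive
  values; the full weighted energy dominates.\<close>

lemma shell_energy_right_limit:
  assumes "h \<longlonglongrightarrow> 0" "\<And>n. h n > 0"
  shows "(\<lambda>n. energy a (b + h n)) \<longlonglongrightarrow> energy a b"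
  unfolding shell_energy_def
proof (rule integral_dominated_convergence[OF _ _ L2_weighted])
  show "(\<lambda>x. indicator {a<..b} (norm x ^ (2 * N)) * (norm (g x) / norm x ^ (N - 1))\<^sup>2) \<in> borel_measurable lebesgue"
    "\<And>n. (\<lambda>x. indicator {a<..b + h n} (norm x ^ (2 * N)) * (norm (g x) / norm x ^ (N - 1))\<^sup>2) \<in> borel_measurable lebesgue"
    using shell_energy_integrable[OF meas_g L2_weighted] by (auto intro: borel_measurable_integrable)
  have "(\<lambda>n. indicator {a<..b + h n} t :: real) \<longlonglongrightarrow> indicator {a<..b} t" for t
  proof (cases "t \<le> b")
    case True
    then have "indicator {a<..b + h n} t = (indicator {a<..b} t :: real)" for n
      using assms(2)[of n] by (auto simp: indicator_def)
    then show ?thesis by simp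
  next
    case False
    then have "\<forall>\<^sub>F n in sequentially. h n < t - b"
      using assms(1) by (intro order_tendstoD(2)) auto
    then have "\<forall>\<^sub>F n in sequentially. (indicator {a<..b} t :: real) = indicator {a<..b + h n} t"
      by eventually_elim (use False in \<open>auto simp: indicator_def\<close>)
    then show ?thesis by (rule Lim_transform_eventually[OF tendsto_const])
  qed
  then show "AE x in lebesgue. (\<lambda>n. indicator {a<..b + h n} (norm x ^ (2 * N)) * (norm (g x) / norm x ^ (N - 1))\<^sup>2)
    \<longlonglongrightarrow> indicator {a<..b} (norm x ^ (2 * N)) * (norm (g x) / norm x ^ (N - 1))\<^sup>2"
    by (intro AE_I2 tendsto_mult tendsto_const)
qed (auto simp: indicator_def)

text \<open>Let h tend to 0 in \<open>average_bound\<close>: by Lebesgue differentiation the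
  averages converge to v outside a null set, and the energy is continuous from the right.\<close>

lemma oscillation:
  obtains G where "AE t in lborel. t > 0 \<longrightarrow> t \<in> G"
    "\<And>a b. a \<in> G \<Longrightarrow> b \<in> G \<Longrightarrow> 0 < a \<Longrightarrow> a < b
      \<Longrightarrow> 4 * (real N)\<^sup>2 * \<beta> * (v a - v b)\<^sup>2 \<le> energy a b * ln (b / a)"
proof -
  \<comment> \<open>Integrability of the profile is known only on the positive half line, so it is
    cut off before the differentiation theorem is applied.\<close>
  define v0 where "v0 t = v t * indicator {0<..} t" for t
  have int_v0: "integrable lborel (\<lambda>t. v0 t * indicator {a..b} t)" for a b
    unfolding v0_def by (rule profile_integrable)
  have HK: "v0 integrable_on cbox a b" "integral (cbox a b) v0 = (\<integral>t. v0 t * indicator {a..b} t \<partial>lborel)" for a b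
  proof -
    have si: "set_integrable lborel {a..b} v0"
      using int_v0[of a b] by (simp add: set_integrable_def mult.commute)
    show "v0 integrable_on cbox a b"
      using set_borel_integral_eq_integral(1)[OF si] by simp
    show "integral (cbox a b) v0 = (\<integral>t. v0 t * indicator {a..b} t \<partial>lborel)"
      using set_borel_integral_eq_integral(2)[OF si] by (simp add: set_lebesgue_integral_def mult.commute)
  qed
  \<comment> \<open>Lebesgue's differentiation theorem for boxes with lower corner x, that is, for
    right-hand averages on the line.\<close>
  obtain M where M: "negligible M" "\<And>x e. \<lbrakk>x \<notin> M; 0 < e\<rbrakk> \<Longrightarrow>
      \<exists>d>0. \<forall>h. 0 < h \<and> h < d \<longrightarrow> norm (integral (cbox x (x + h *\<^sub>R One)) v0 /\<^sub>R h ^ DIM(real) - v0 x) < e"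
    using integrable_ccontinuous_explicit[of v0] HK(1) by metis
  have avg: "(\<lambda>n. (\<integral>t. v t * indicator {a<..a + 1 / real (Suc n)} t \<partial>lborel) / (1 / real (Suc n))) \<longlonglongrightarrow> v a"
    if a: "a \<notin> M" "a > 0" for a
  proof (rule LIMSEQ_I)
    fix e :: real assume "e > 0"
    from M(2)[OF a(1) this] obtain d where d: "d > 0"
      "\<And>h. 0 < h \<Longrightarrow> h < d \<Longrightarrow> \<bar>integral (cbox a (a + h)) v0 / h - v0 a\<bar> < e"
      by (auto simp: divide_inverse mult.commute)
    obtain n0 where n0: "inverse (real (Suc n0)) < d" using reals_Archimedean[OF d(1)] by blast
    have "norm ((\<integral>t. v t * indicator {a<..a + 1 / real (Suc n)} t \<partial>lborel) / (1 / real (Suc n)) - v a) < e"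
      if n: "n \<ge> n0" for n
    proof -
      let ?h = "1 / real (Suc n)"
      have "?h \<le> 1 / real (Suc n0)" using n by (intro divide_left_mono) auto
      then have h: "0 < ?h" "?h < d" using n0 by (auto simp: inverse_eq_divide)
      have "(\<integral>t. v t * indicator {a<..a + ?h} t \<partial>lborel) = (\<integral>t. v0 t * indicator {a..a + ?h} t \<partial>lborel)"
      proof (rule integral_cong_AE)
        show "AE t in lborel. v t * indicator {a<..a + ?h} t = v0 t * indicator {a..a + ?h} t"
          using AE_lborel_singleton[of a] by eventually_elim (use a in \<open>auto simp: v0_def indicator_def\<close>)
      qed (unfold v0_def, measurable)
      moreover have "v0 a = v a" using a by (simp add: v0_def)
      ultimately show ?thesis
        using d(2)[OF h] unfolding HK(2) real_norm_def by (simp only:)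
    qed
    then show "\<exists>n0. \<forall>n\<ge>n0. norm ((\<integral>t. v t * indicator {a<..a + 1 / real (Suc n)} t \<partial>lborel) / (1 / real (Suc n)) - v a) < e"
      by blast
  qed
  show ?thesis
  proof (rule that[of "- M"])
    have "AE t in lebesgue. t \<notin> M"
      using M(1) by (intro AE_not_in) (simp add: negligible_iff_null_sets)
    then show "AE t in lborel. t > 0 \<longrightarrow> t \<in> - M"
      by (subst (asm) AE_completion_iff) (auto elim: eventually_mono)
    fix a b assume ab: "a \<in> - M" "b \<in> - M" "0 < a" "a < b"
    let ?h = "\<lambda>n. 1 / real (Suc n)"
    have h0: "?h \<longlonglongrightarrow> 0" using LIMSEQ_inverse_real_of_nat by (simp add: inverse_eq_divide)
    have "(2 * real N * \<beta> * \<bar>v a - v b\<bar>)\<^sup>2 \<le> energy a b * (\<beta> * ln ((b + 2 * 0) / a))"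
    proof (rule LIMSEQ_le)
      show "(\<lambda>n. (2 * real N * \<beta> * \<bar>(\<integral>t. v t * indicator {a<..a + ?h n} t \<partial>lborel) / ?h n
        - (\<integral>t. v t * indicator {b<..b + ?h n} t \<partial>lborel) / ?h n\<bar>)\<^sup>2) \<longlonglongrightarrow> (2 * real N * \<beta> * \<bar>v a - v b\<bar>)\<^sup>2"
        using ab by (intro tendsto_intros avg) auto
      have "(\<lambda>n. energy a (b + 2 * ?h n)) \<longlonglongrightarrow> energy a b"
        by (rule shell_energy_right_limit) (use tendsto_mult_left[OF h0, of 2] in simp_all)
      then show "(\<lambda>n. energy a (b + 2 * ?h n) * (\<beta> * ln ((b + 2 * ?h n) / a))) \<longlonglongrightarrow> energy a b * (\<beta> * ln ((b + 2 * 0) / a))"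
        using ab by (intro tendsto_mult tendsto_const tendsto_ln tendsto_divide tendsto_add h0) auto
      show "\<exists>n0. \<forall>n\<ge>n0. (2 * real N * \<beta> * \<bar>(\<integral>t. v t * indicator {a<..a + ?h n} t \<partial>lborel) / ?h n
        - (\<integral>t. v t * indicator {b<..b + ?h n} t \<partial>lborel) / ?h n\<bar>)\<^sup>2 \<le> energy a (b + 2 * ?h n) * (\<beta> * ln ((b + 2 * ?h n) / a))"
        using ab by (intro exI[of _ 0] allI impI average_bound) auto
    qed
    \<comment> \<open>The square contains \<beta>^2 and the right side only \<beta>; one factor
      cancels and leaves the constant \<gamma>_N.\<close>
    then have "\<beta> * (4 * (real N)\<^sup>2 * \<beta> * (v a - v b)\<^sup>2) \<le> \<beta> * (energy a b * ln (b / a))"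
      by (simp add: power_mult_distrib power2_eq_square mult_ac)
    then show "4 * (real N)\<^sup>2 * \<beta> * (v a - v b)\<^sup>2 \<le> energy a b * ln (b / a)"
      using \<beta>_pos by (subst (asm) mult_le_cancel_left_pos) auto
  qed
qed

end

subsection \<open>The critical case\<close>

text \<open>This identifies the constant of the theorem, via the unit ball volume pi^N / N!, with
  the one produced by the oscillation estimate.\<close>

lemma gammaN_unit_ball_vol:
  assumes "N > 0"
  shows "gammaN N = 4 * (real N)\<^sup>2 * unit_ball_vol (2 * real N)"
proof -
  have "unit_ball_vol (2 * real N) = pi ^ N / fact N" using unit_ball_vol_even[of N] by simp
  moreover have "(fact N :: real) = real N * fact (N - 1)" using assms by (simp add: fact_reduce)
  ultimately show ?thesis using assms by (simp add: gammaN_def power2_eq_square)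
qed

text \<open>This covers the exponent \<gamma>_N itself: w = sqrt(\<gamma>_N) v turns the oscillation
  estimate into the one with constant 1, as \<open>ruf_inequality\<close> requires. The bound is
  uniform over the unit ball.\<close>

lemma subcritical_bound:
  fixes u :: "real^'n::finite \<Rightarrow> real"
  assumes N: "N > 0" and card: "CARD('n) = 2 * N" and u: "u \<in> Hrad_ball N"
  shows "(\<integral>\<^sup>+ x. ennreal (exp (gammaN N * (u x)\<^sup>2) - 1) \<partial>lebesgue)
    \<le> ennreal (unit_ball_vol (2 * real N)) * ennreal (exp 2 * moser_const * (16 * (real N)\<^sup>2) + exp 4 * (4 * (real N)\<^sup>2))"
proof -
  from u obtain g where rad: "radial u" and meas: "u \<in> borel_measurable lebesgue" "g \<in> borel_measurable lebesgue"
    and wg: "weak_grad u g" and L2: "integrable lebesgue (\<lambda>x. (u x)\<^sup>2)" "integrable lebesgue (\<lambda>x. (norm (g x))\<^sup>2)"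
      "integrable lebesgue (\<lambda>x. (norm (g x) / norm x ^ (N - 1))\<^sup>2)"
    and ball: "(\<integral>x. (u x)\<^sup>2 \<partial>lebesgue) + (\<integral>x. (norm (g x))\<^sup>2 \<partial>lebesgue)
          + (\<integral>x. (norm (g x) / norm x ^ (N - 1))\<^sup>2 \<partial>lebesgue) \<le> 1"
    by (auto simp: Hrad_ball_def)
  obtain v where v: "v \<in> borel_measurable borel" "AE x in lborel. u x = v (norm x ^ CARD('n))"
    using radial_borel_profile[OF rad meas(1)] by blast
  interpret radial_sobolev u g N v
    by unfold_locales (use N card meas wg L2 v in auto)
  define D where "D = (\<integral>x. (u x)\<^sup>2 \<partial>lebesgue)"
  define \<gamma> where "\<gamma> = gammaN N"
  have \<gamma>: "\<gamma> = 4 * (real N)\<^sup>2 * \<beta>" using gammaN_unit_ball_vol[OF N] by (simp add: \<gamma>_def)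
  have \<gamma>0: "\<gamma> > 0" using N \<beta>_pos unfolding \<gamma> by simp
  \<comment> \<open>The squared L2 norm of u is \<beta> times the integral of v^2, hence c times
    that of w^2. The value 1/(4 N^2) explains 16 N^2 and 4 N^2 in the bound.\<close>
  define c where "c = \<beta> / \<gamma>"
  have c: "c = 1 / (4 * (real N)\<^sup>2)" using order_less_imp_not_eq2[OF \<beta>_pos] N by (simp add: c_def \<gamma>)
  have c0: "c > 0" using N by (simp add: c)
  have D0: "D \<ge> 0" by (simp add: D_def)
  have ED: "(\<integral>x. (norm (g x) / norm x ^ (N - 1))\<^sup>2 \<partial>lebesgue) \<le> 1 - D"
  proof -
    have "0 \<le> (\<integral>x. (norm (g x))\<^sup>2 \<partial>lebesgue)" by simp
    then show ?thesis using ball unfolding D_def by linarith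
  qed
  obtain G where G: "AE t in lborel. t > 0 \<longrightarrow> t \<in> G"
    "\<And>a b. a \<in> G \<Longrightarrow> b \<in> G \<Longrightarrow> 0 < a \<Longrightarrow> a < b
      \<Longrightarrow> 4 * (real N)\<^sup>2 * \<beta> * (v a - v b)\<^sup>2 \<le> energy a b * ln (b / a)"
    using oscillation by blast
  define w where "w t = sqrt \<gamma> * v t" for t
  have w2: "(w t)\<^sup>2 = \<gamma> * (v t)\<^sup>2" for t using \<gamma>0 by (simp add: w_def power_mult_distrib)
  have "(\<integral>\<^sup>+ t. ennreal (exp ((w t)\<^sup>2) - 1) * indicator {0<..} t \<partial>lborel)
    \<le> ennreal (exp 2 * moser_const * (4 / c) + exp 4 / c)"
  proof (rule ruf_inequality[where D = D and m = energy, OF c0 D0 _ G(1)])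
    show "w \<in> borel_measurable borel" unfolding w_def by measurable
    show "(w a - w b)\<^sup>2 \<le> energy a b * ln (b / a)" if "a \<in> G" "b \<in> G" "0 < a" "a < b" for a b
    proof -
      have "(w a - w b)\<^sup>2 = \<gamma> * (v a - v b)\<^sup>2"
        using \<gamma>0 by (simp add: w_def power_mult_distrib flip: right_diff_distrib)
      then show ?thesis using G(2)[OF that] by (simp add: \<gamma>)
    qed
    show "energy a b \<le> 1 - D" for a b using shell_energy_le[of a b] ED by linarith
    show "energy a b + energy b c \<le> 1 - D" if "a < b" "b < c" for a b c
      using shell_energy_add_le[OF that] ED by linarith
    have "ennreal D = (\<integral>\<^sup>+ x. ennreal ((u x)\<^sup>2) \<partial>lebesgue)"
      unfolding D_def by (rule nn_integral_eq_integral[symmetric]) (use L2 in auto)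
    also have "\<dots> = ennreal \<beta> * (\<integral>\<^sup>+ t. ennreal ((v t)\<^sup>2) * indicator {0<..} t \<partial>lborel)"
      by (rule nn_integral_profile) measurable
    also have "\<dots> = (\<integral>\<^sup>+ t. ennreal \<beta> * (ennreal ((v t)\<^sup>2) * indicator {0<..} t) \<partial>lborel)"
      by (rule nn_integral_cmult[symmetric]) measurable
    also have "\<dots> = (\<integral>\<^sup>+ t. ennreal (c * (w t)\<^sup>2) * indicator {0<..} t \<partial>lborel)"
      using \<gamma>0 by (intro nn_integral_cong) (simp add: w2 c_def ennreal_mult mult.assoc)
    finally show "(\<integral>\<^sup>+ t. ennreal (c * (w t)\<^sup>2) * indicator {0<..} t \<partial>lborel) \<le> ennreal D" by simp
  qed (rule shell_energy_nonneg)
  also have "exp 2 * moser_const * (4 / c) + exp 4 / c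
      = exp 2 * moser_const * (16 * (real N)\<^sup>2) + exp 4 * (4 * (real N)\<^sup>2)"
    by (simp add: c)
  finally have "(\<integral>\<^sup>+ t. ennreal (exp (\<gamma> * (v t)\<^sup>2) - 1) * indicator {0<..} t \<partial>lborel)
    \<le> ennreal (exp 2 * moser_const * (16 * (real N)\<^sup>2) + exp 4 * (4 * (real N)\<^sup>2))"
    by (simp add: w2)
  then show ?thesis
    using nn_integral_profile[of "\<lambda>y. ennreal (exp (\<gamma> * y\<^sup>2) - 1)"]
    by (simp add: \<gamma>_def mult_left_mono)
qed

lemma MT_sup_finite:
  assumes N: "N > 0" and card: "CARD('n::finite) = 2 * N"
  shows "MT_sup N (gammaN N) TYPE('n) < \<infinity>"
proof -
  have "MT_sup N (gammaN N) TYPE('n) \<le> ennreal (unit_ball_vol (2 * real N)) *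
      ennreal (exp 2 * moser_const * (16 * (real N)\<^sup>2) + exp 4 * (4 * (real N)\<^sup>2))"
    unfolding MT_sup_def by (intro SUP_least subcritical_bound[OF N card])
  also have "\<dots> < \<infinity>" by (simp add: ennreal_mult_less_top)
  finally show ?thesis .
qed

subsection \<open>Weak gradients of Lipschitz functions\<close>

text \<open>The partials are continuous and vanish outside a ball, hence bounded; the mean value
  inequality then gives a global constant, needed to dominate difference quotients.\<close>

lemma test_fun_lipschitz:
  fixes \<phi> :: "real^'n::finite \<Rightarrow> real"
  assumes tf: "test_fun \<phi>"
  obtains B where "\<And>x y. \<bar>\<phi> x - \<phi> y\<bar> \<le> B * norm (x - y)"
proof -
  obtain R where R: "\<And>x i. norm x > R \<Longrightarrow> partial \<phi> i x = 0"
    using test_fun_support(4)[OF tf] by blast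
  have "\<exists>B. \<forall>x. \<bar>partial \<phi> i x\<bar> \<le> B" for i
  proof -
    have "bounded (partial \<phi> i ` cball 0 R)"
      by (intro compact_imp_bounded compact_continuous_image continuous_on_subset[OF test_fun_support(2)[OF tf]]) auto
    then obtain B where B: "\<And>x. x \<in> cball 0 R \<Longrightarrow> \<bar>partial \<phi> i x\<bar> \<le> B"
      unfolding bounded_iff by (metis image_eqI real_norm_def)
    have "\<bar>partial \<phi> i x\<bar> \<le> max B 0" for x
      using B[of x] R[of x i] by (cases "norm x \<le> R") auto
    then show ?thesis by blast
  qed
  then obtain B where B: "\<And>i x. \<bar>partial \<phi> i x\<bar> \<le> B i" by metis
  have "norm (\<phi> x - \<phi> y) \<le> (\<Sum>i\<in>UNIV. B i) * norm (x - y)" for x y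
  proof (rule differentiable_bound[of UNIV \<phi> "\<lambda>x. frechet_derivative \<phi> (at x)"])
    fix z :: "real^'n"
    let ?D = "frechet_derivative \<phi> (at z)"
    show "(\<phi> has_derivative ?D) (at z within UNIV)" using test_fun_support(3)[OF tf] by simp
    then have lin: "linear ?D" by (rule has_derivative_linear)
    show "onorm ?D \<le> (\<Sum>i\<in>UNIV. B i)"
    proof (rule onorm_le)
      fix h :: "real^'n"
      have "?D h = ?D (\<Sum>i\<in>UNIV. h $ i *\<^sub>R axis i 1)"
        using basis_expansion[of h] by (simp add: scalar_mult_eq_scaleR)
      also have "\<dots> = (\<Sum>i\<in>UNIV. h $ i * partial \<phi> i z)"
        by (simp add: linear_sum[OF lin] linear_cmul[OF lin] partial_def)
      also have "\<bar>\<dots>\<bar> \<le> (\<Sum>i\<in>UNIV. \<bar>h $ i * partial \<phi> i z\<bar>)" by (rule sum_abs)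
      also have "\<dots> \<le> (\<Sum>i\<in>UNIV. norm h * B i)"
        using B by (auto intro!: sum_mono mult_mono component_le_norm_cart simp: abs_mult)
      finally show "norm (?D h) \<le> (\<Sum>i\<in>UNIV. B i) * norm h"
        by (simp add: sum_distrib_left sum_distrib_right mult.commute)
    qed
  qed auto
  then show ?thesis using that by (simp only: real_norm_def) blast
qed

text \<open>Translation invariance makes the integral of every difference quotient of \<open>u \<phi>\<close> vanish.\<close>
lemma weak_grad_lipschitz:
  fixes u :: "real^'n::finite \<Rightarrow> real"
  assumes lip: "\<And>x y. \<bar>u x - u y\<bar> \<le> K * norm (x - y)" and bd: "\<And>x. \<bar>u x\<bar> \<le> B"
    and [measurable]: "g \<in> borel_measurable borel"
    and der: "AE x in lborel. (u has_derivative (\<lambda>h. g x \<bullet> h)) (at x)"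
  shows "weak_grad u g"
  unfolding weak_grad_def
proof (intro allI impI)
  fix \<phi> :: "real^'n \<Rightarrow> real" and i :: 'n
  assume tf: "test_fun \<phi>"
  let ?e = "axis i 1 :: real^'n"
  obtain K' where lip\<phi>: "\<And>x y. \<bar>\<phi> x - \<phi> y\<bar> \<le> K' * norm (x - y)" using test_fun_lipschitz[OF tf] by blast
  obtain R where R: "\<And>x. norm x > R \<Longrightarrow> \<phi> x = 0" "\<And>x i. norm x > R \<Longrightarrow> partial \<phi> i x = 0"
    using test_fun_support(4)[OF tf] by blast
  have K0: "K \<ge> 0" "K' \<ge> 0"
  proof -
    have e1: "norm (?e - 0) = 1" by simp
    show "K \<ge> 0" using lip[of ?e 0] unfolding e1 by linarith
    show "K' \<ge> 0" using lip\<phi>[of ?e 0] unfolding e1 by linarith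
  qed
  have B0: "B \<ge> 0" using bd[of 0] by linarith
  have cont_u: "continuous_on UNIV u"
    by (rule lipschitz_on_continuous_on[of K]) (use lip K0 in \<open>auto intro!: lipschitz_onI simp: dist_norm\<close>)
  note cont_\<phi> = test_fun_support(1)[OF tf] and cont_d = test_fun_support(2)[OF tf, of i]
  have [measurable]: "u \<in> borel_measurable borel" "\<phi> \<in> borel_measurable borel" "partial \<phi> i \<in> borel_measurable borel"
    using cont_u cont_\<phi> cont_d by (auto intro: borel_measurable_continuous_onI)
  have int_cs: "integrable lborel f" if "continuous_on UNIV f" "\<And>x. norm x > R \<Longrightarrow> f x = 0" for f :: "real^'n \<Rightarrow> real"
  proof -
    have "integrable lborel (\<lambda>x. indicator (cball 0 R) x *\<^sub>R f x)"
      by (intro borel_integrable_compact continuous_on_subset[OF that(1)]) auto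
    also have "(\<lambda>x. indicator (cball 0 R) x *\<^sub>R f x) = f"
      using that(2) by (auto simp: indicator_def fun_eq_iff not_le)
    finally show ?thesis .
  qed
  define F where "F x = u x * \<phi> x" for x
  have [measurable]: "F \<in> borel_measurable borel" unfolding F_def by measurable
  have intF: "integrable lborel F"
    unfolding F_def[abs_def] by (rule int_cs) (use cont_u cont_\<phi> R in \<open>auto intro!: continuous_intros\<close>)
  \<comment> \<open>A product of bounded Lipschitz functions is Lipschitz. The bound for \<phi>
    comes from its own Lipschitz constant on the ball containing its support.\<close>
  have lipF: "\<bar>F x - F y\<bar> \<le> (\<bar>\<phi> 0\<bar> + K' * (\<bar>R\<bar> + 1)) * K * norm (x - y) + B * K' * norm (x - y)" for x y
  proof -
    have \<phi>b: "\<bar>\<phi> x\<bar> \<le> \<bar>\<phi> 0\<bar> + K' * (\<bar>R\<bar> + 1)" for x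
    proof (cases "norm x \<le> R")
      case True
      then have "K' * norm x \<le> K' * (\<bar>R\<bar> + 1)" using K0 by (intro mult_left_mono) auto
      then show ?thesis using lip\<phi>[of x 0] unfolding diff_zero by linarith
    next
      case False
      then show ?thesis using R K0 by (simp add: add_nonneg_nonneg)
    qed
    have "F x - F y = \<phi> x * (u x - u y) + u y * (\<phi> x - \<phi> y)" by (simp add: F_def algebra_simps)
    also have "\<bar>\<dots>\<bar> \<le> \<bar>\<phi> x\<bar> * \<bar>u x - u y\<bar> + \<bar>u y\<bar> * \<bar>\<phi> x - \<phi> y\<bar>"
      using abs_triangle_ineq by (simp flip: abs_mult)
    also have "\<dots> \<le> (\<bar>\<phi> 0\<bar> + K' * (\<bar>R\<bar> + 1)) * (K * norm (x - y)) + B * (K' * norm (x - y))"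
      using \<phi>b bd lip lip\<phi> B0 K0 by (intro add_mono mult_mono) auto
    finally show ?thesis by (simp add: mult.assoc)
  qed
  define C where "C = (\<bar>\<phi> 0\<bar> + K' * (\<bar>R\<bar> + 1)) * K + B * K'"
  have lipF: "\<bar>F x - F y\<bar> \<le> C * norm (x - y)" for x y using lipF[of x y] by (simp add: C_def algebra_simps)
  let ?h = "\<lambda>n. 1 / real (Suc n)"
  define q where "q n x = (F (?h n *\<^sub>R ?e + x) - F x) / ?h n" for n x
  define G where "G x = (g x \<bullet> ?e) * \<phi> x + u x * partial \<phi> i x" for x
  have [measurable]: "G \<in> borel_measurable borel" unfolding G_def by measurable
  \<comment> \<open>Both terms of the difference quotient have the same integral, so the product
    rule in the limit becomes integration by parts.\<close>
  have intq: "(\<integral>x. q n x \<partial>lborel) = 0" for n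
  proof -
    have "(\<integral>x. F x \<partial>lborel) = (\<integral>x. F x \<partial>distr lborel borel ((+) (?h n *\<^sub>R ?e)))"
      by (simp add: lborel_distr_plus)
    also have "\<dots> = (\<integral>x. F (?h n *\<^sub>R ?e + x) \<partial>lborel)" by (rule integral_distr) auto
    finally have "(\<integral>x. F (?h n *\<^sub>R ?e + x) \<partial>lborel) = (\<integral>x. F x \<partial>lborel)" ..
    moreover have "integrable lborel (\<lambda>x. F (?h n *\<^sub>R ?e + x))"
    proof -
      have "integrable (distr lborel borel ((+) (?h n *\<^sub>R ?e))) F" by (simp add: lborel_distr_plus intF)
      then show ?thesis by (subst (asm) integrable_distr_eq) auto
    qed
    ultimately show ?thesis unfolding q_def using intF by simp
  qed
  have qlim: "AE x in lborel. (\<lambda>n. q n x) \<longlonglongrightarrow> G x"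
    using der
  proof eventually_elim
    case (elim x)
    have "(F has_derivative (\<lambda>h. u x * frechet_derivative \<phi> (at x) h + (g x \<bullet> h) * \<phi> x)) (at x)"
      unfolding F_def[abs_def] by (rule has_derivative_mult[OF elim test_fun_support(3)[OF tf]])
    then have dF: "(F has_derivative (\<lambda>h. u x * frechet_derivative \<phi> (at x) h + (g x \<bullet> h) * \<phi> x)) (at (0 *\<^sub>R ?e + x))"
      by simp
    have "((\<lambda>t. t *\<^sub>R ?e + x) has_derivative (\<lambda>t. t *\<^sub>R ?e)) (at 0)"
      by (auto intro!: derivative_eq_intros)
    from has_derivative_compose[OF this dF]
    have "((\<lambda>t. F (t *\<^sub>R ?e + x)) has_derivative
        (\<lambda>t. u x * frechet_derivative \<phi> (at x) (t *\<^sub>R ?e) + (g x \<bullet> (t *\<^sub>R ?e)) * \<phi> x)) (at 0)" .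
    moreover have "(\<lambda>t. u x * frechet_derivative \<phi> (at x) (t *\<^sub>R ?e) + (g x \<bullet> (t *\<^sub>R ?e)) * \<phi> x) = (*) (G x)"
      using linear_cmul[OF has_derivative_linear[OF test_fun_support(3)[OF tf, of x]]]
      by (auto simp: G_def partial_def algebra_simps)
    ultimately have "((\<lambda>t. F (t *\<^sub>R ?e + x)) has_real_derivative G x) (at 0)"
      by (simp add: has_field_derivative_def)
    then have "((\<lambda>t. (F (t *\<^sub>R ?e + x) - F x) / t) \<longlongrightarrow> G x) (at 0)"
      by (simp add: DERIV_def)
    moreover have "filterlim ?h (at 0) sequentially"
      by (rule filterlim_atI) (use LIMSEQ_inverse_real_of_nat in \<open>auto simp: inverse_eq_divide\<close>)
    ultimately show ?case unfolding q_def by (rule filterlim_compose)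
  qed
  \<comment> \<open>All increments are at most 1, so the quotients vanish beyond radius |R|+1;
    inside, the Lipschitz constant \<open>C\<close> bounds them.\<close>
  define w where "w x = indicator (cball 0 (\<bar>R\<bar> + 1)) x * C" for x :: "real^'n"
  have intw: "integrable lborel w"
    unfolding w_def by (intro integrable_mult_left integrable_real_indicator) (auto simp: emeasure_cball)
  have qw: "norm (q n x) \<le> w x" for n x
  proof (cases "norm x \<le> \<bar>R\<bar> + 1")
    case True
    have "\<bar>q n x\<bar> = \<bar>F (?h n *\<^sub>R ?e + x) - F x\<bar> / ?h n" by (simp add: q_def abs_mult)
    also have "\<dots> \<le> (C * norm (?h n *\<^sub>R ?e + x - x)) / ?h n"
      by (rule divide_right_mono[OF lipF]) simp
    also have "\<dots> = C" by simp
    finally show ?thesis using True by (simp add: w_def)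
  next
    case False
    have "?h n \<le> 1" by simp
    moreover have "norm x \<le> norm (?h n *\<^sub>R ?e + x) + norm (?h n *\<^sub>R ?e)"
      using norm_triangle_ineq4[of "?h n *\<^sub>R ?e + x" "?h n *\<^sub>R ?e"] by simp
    moreover have "norm (?h n *\<^sub>R ?e) = ?h n" by simp
    ultimately have "norm (?h n *\<^sub>R ?e + x) > R" "norm x > R" using False by linarith+
    then show ?thesis using False R by (simp add: q_def F_def w_def)
  qed
  have "(\<lambda>n. \<integral>x. q n x \<partial>lborel) \<longlonglongrightarrow> (\<integral>x. G x \<partial>lborel)" and intG: "integrable lborel G"
  proof -
    have [measurable]: "q n \<in> borel_measurable borel" for n unfolding q_def by measurable
    show "(\<lambda>n. \<integral>x. q n x \<partial>lborel) \<longlonglongrightarrow> (\<integral>x. G x \<partial>lborel)"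
      by (rule integral_dominated_convergence[OF _ _ intw qlim]) (use qw in auto)
    show "integrable lborel G"
      by (rule integrable_dominated_convergence[OF _ _ intw qlim]) (use qw in auto)
  qed
  then have G0: "(\<integral>x. G x \<partial>lborel) = 0" by (simp add: intq LIMSEQ_const_iff)
  have int1: "integrable lborel (\<lambda>x. u x * partial \<phi> i x)"
    by (rule int_cs) (use cont_u cont_d R in \<open>auto intro!: continuous_intros\<close>)
  have "(\<lambda>x. g x $ i * \<phi> x) = (\<lambda>x. G x - u x * partial \<phi> i x)"
    by (simp add: G_def inner_axis)
  then have "(\<integral>x. g x $ i * \<phi> x \<partial>lborel) = - (\<integral>x. u x * partial \<phi> i x \<partial>lborel)"
    using intG int1 G0 by simp
  moreover have "(\<lambda>x. g x $ i) \<in> borel_measurable borel"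
    by (rule measurable_compose[OF \<open>g \<in> borel_measurable borel\<close>]) (intro borel_measurable_continuous_onI continuous_intros)
  ultimately show "(\<integral>x. u x * partial \<phi> i x \<partial>lebesgue) = - (\<integral>x. g x $ i * \<phi> x \<partial>lebesgue)"
    by (simp add: integral_completion)
qed

subsection \<open>Moser functions\<close>

text \<open>In the variable t the integrand is t^(-1/2) on (0, 1], with integral 2. It majorises the
  two unweighted parts of the norm of a Moser function, up to the factor c^2.\<close>

lemma integrable_inverse_sqrt_ball:
  defines "f \<equiv> (\<lambda>x::'a::euclidean_space. indicator {0<..1} (norm x ^ DIM('a)) * (1 / sqrt (norm x ^ DIM('a))))"
  shows "integrable lebesgue f" "(\<integral>x. f x \<partial>lebesgue) = 2 * unit_ball_vol DIM('a)"
proof -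
  have [measurable]: "f \<in> borel_measurable lborel" unfolding f_def by measurable
  have nn: "f x \<ge> 0" for x by (simp add: f_def)
  have "((\<lambda>t. t powr (- 1 / 2)) has_integral (1 powr (- 1 / 2 + 1) / (- 1 / 2 + 1))) {0..1::real}"
    by (rule has_integral_powr_from_0) auto
  then have "((\<lambda>t. t powr (- 1 / 2)) has_integral 2) {0..1::real}" by simp
  then have powr: "(\<integral>\<^sup>+ t. ennreal (indicator {0..1} t * t powr (- 1 / 2)) \<partial>lborel) = ennreal 2"
    by (rule nn_integral_has_integral_lebesgue[rotated]) auto
  have "(\<integral>\<^sup>+ x. ennreal (f x) \<partial>lborel)
    = ennreal (unit_ball_vol DIM('a)) * (\<integral>\<^sup>+ t. ennreal (indicator {0<..1} t * (1 / sqrt t)) * indicator {0<..} t \<partial>lborel)"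
    unfolding f_def by (subst nn_integral_norm_power[symmetric]) auto
  also have "(\<integral>\<^sup>+ t. ennreal (indicator {0<..1} t * (1 / sqrt t)) * indicator {0<..} t \<partial>lborel)
    = (\<integral>\<^sup>+ t. ennreal (indicator {0..1} t * t powr (- 1 / 2)) \<partial>lborel)"
    by (intro nn_integral_cong) (auto simp: indicator_def powr_minus_divide powr_half_sqrt)
  also note powr
  finally have *: "(\<integral>\<^sup>+ x. ennreal (f x) \<partial>lborel) = ennreal (2 * unit_ball_vol DIM('a))"
    by (simp add: ennreal_mult mult.commute)
  have "has_bochner_integral lborel f (2 * unit_ball_vol DIM('a))"
    by (rule has_bochner_integral_nn_integral) (use nn * in auto)
  then show "integrable lebesgue f" "(\<integral>x. f x \<partial>lebesgue) = 2 * unit_ball_vol DIM('a)"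
    by (auto simp: has_bochner_integral_iff integrable_completion integral_completion)
qed

text \<open>Clamping the norm to [\<rho>, 1] gives the truncated logarithm: constant on the small
  ball, zero outside the unit ball, and Lipschitz as a composition.\<close>

definition moser_fun :: "real \<Rightarrow> real \<Rightarrow> real^'n \<Rightarrow> real" where
  "moser_fun c \<rho> x = - c * ln (max \<rho> (min 1 (norm x)))"

definition moser_grad :: "real \<Rightarrow> real \<Rightarrow> real^'n \<Rightarrow> real^'n" where
  "moser_grad c \<rho> x = (if \<rho> < norm x \<and> norm x < 1 then (- c / (norm x)\<^sup>2) *\<^sub>R x else 0)"

text \<open>The clamp is 1-Lipschitz and ln has constant 1/\<rho> on [\<rho>, \<infinity>), so the
  criterion for Lipschitz functions applies once the classical derivative is known off the two
  spheres.\<close>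

lemma weak_grad_moser:
  assumes \<rho>: "0 < \<rho>" "\<rho> < 1"
  shows "weak_grad (moser_fun c \<rho> :: real^'n::finite \<Rightarrow> real) (moser_grad c \<rho>)"
proof (rule weak_grad_lipschitz)
  let ?p = "\<lambda>x::real^'n. max \<rho> (min 1 (norm x))"
  have ln_lip: "\<bar>ln s - ln t\<bar> \<le> \<bar>s - t\<bar> / \<rho>" if "s \<ge> \<rho>" "t \<ge> \<rho>" for s t :: real
  proof -
    have *: "ln s - ln t \<le> \<bar>s - t\<bar> / \<rho>" if "s \<ge> \<rho>" "t \<ge> \<rho>" for s t :: real
    proof -
      have "ln s - ln t = ln (s / t)" using that \<rho> by (simp add: ln_div)
      also have "\<dots> \<le> s / t - 1" using that \<rho> by (intro ln_le_minus_one) auto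
      also have "\<dots> = (s - t) / t" using that \<rho> by (simp add: field_simps)
      also have "\<dots> \<le> \<bar>s - t\<bar> / t" using that \<rho> by (intro divide_right_mono) auto
      also have "\<dots> \<le> \<bar>s - t\<bar> / \<rho>" using that \<rho> by (intro divide_left_mono) auto
      finally show ?thesis .
    qed
    from *[OF that] *[OF that(2,1)] show ?thesis by (simp add: abs_minus_commute abs_le_iff)
  qed
  show "\<bar>moser_fun c \<rho> x - moser_fun c \<rho> y\<bar> \<le> (\<bar>c\<bar> / \<rho>) * norm (x - y)" for x y :: "real^'n"
  proof -
    have "\<bar>moser_fun c \<rho> x - moser_fun c \<rho> y\<bar> = \<bar>c\<bar> * \<bar>ln (?p x) - ln (?p y)\<bar>"
    proof -
      have "moser_fun c \<rho> x - moser_fun c \<rho> y = - (c * (ln (?p x) - ln (?p y)))"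
        by (simp add: moser_fun_def algebra_simps)
      then show ?thesis by (simp add: abs_mult)
    qed
    also have "\<dots> \<le> \<bar>c\<bar> * (\<bar>?p x - ?p y\<bar> / \<rho>)" by (intro mult_left_mono ln_lip) auto
    also have "\<dots> \<le> \<bar>c\<bar> * (norm (x - y) / \<rho>)"
    proof -
      have "\<bar>?p x - ?p y\<bar> \<le> \<bar>norm x - norm y\<bar>" by (auto simp: max_def min_def)
      also have "\<dots> \<le> norm (x - y)" by (rule norm_triangle_ineq3)
      finally show ?thesis using \<rho> by (intro mult_left_mono divide_right_mono) auto
    qed
    finally show ?thesis by simp
  qed
  show "\<bar>moser_fun c \<rho> x\<bar> \<le> \<bar>c\<bar> * \<bar>ln \<rho>\<bar>" for x :: "real^'n"
  proof -
    have "ln \<rho> \<le> ln (?p x)" using \<rho> by (subst ln_le_cancel_iff) auto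
    moreover have "ln (?p x) \<le> 0" using \<rho> by (subst ln_le_zero_iff) auto
    ultimately show ?thesis unfolding moser_fun_def abs_mult by (intro mult_mono) auto
  qed
  show "(moser_grad c \<rho> :: real^'n \<Rightarrow> _) \<in> borel_measurable borel"
    unfolding moser_grad_def by measurable
  \<comment> \<open>The formula for the gradient is claimed only off the radii \<rho> and 1, where
    the function has corners.\<close>
  have sphere: "AE x in lborel. norm (x::real^'n) \<noteq> r" for r
  proof -
    have "sphere (0::real^'n) r \<in> null_sets lborel"
      using negligible_sphere[of "0::real^'n" r] by (auto simp: negligible_iff_null_sets null_sets_completion_iff)
    from AE_not_in[OF this] show ?thesis by (auto elim: eventually_mono)
  qed
  show "AE x in lborel. (moser_fun c \<rho> has_derivative (\<lambda>h. moser_grad c \<rho> x \<bullet> h)) (at (x::real^'n))"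
    using sphere[of \<rho>] sphere[of 1]
  proof eventually_elim
    case (elim x)
    consider "norm x < \<rho>" | "\<rho> < norm x" "norm x < 1" | "norm x > 1" using elim by linarith
    then show ?case
    proof cases
      case 1
      have "(moser_fun c \<rho> has_derivative (\<lambda>h. 0)) (at x)"
      proof (rule has_derivative_transform_within_open[OF has_derivative_const])
        show "open (ball 0 \<rho>)" "x \<in> ball 0 \<rho>" using 1 by auto
        show "- c * ln \<rho> = moser_fun c \<rho> y" if "y \<in> ball 0 \<rho>" for y :: "real^'n"
          using that \<rho> by (simp add: moser_fun_def max_def min_def)
      qed
      moreover have "moser_grad c \<rho> x = 0" using 1 by (simp add: moser_grad_def)
      ultimately show ?thesis by simp
    next
      case 3
      have "(moser_fun c \<rho> has_derivative (\<lambda>h. 0)) (at x)"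
      proof (rule has_derivative_transform_within_open[OF has_derivative_const])
        show "open (- cball (0::real^'n) 1)" "x \<in> - cball 0 1" using 3 by auto
        show "- c * ln 1 = moser_fun c \<rho> y" if "y \<in> - cball 0 1" for y :: "real^'n"
          using that \<rho> by (simp add: moser_fun_def max_def min_def)
      qed
      moreover have "moser_grad c \<rho> x = 0" using 3 by (simp add: moser_grad_def)
      ultimately show ?thesis by simp
    next
      case 2
      then have x: "x \<noteq> 0" "norm x > 0" using \<rho> by auto
      have "((\<lambda>y. - c * ln (norm y)) has_derivative (\<lambda>h. - c * (inverse (norm x) * (h \<bullet> sgn x)))) (at x)"
        by (rule has_derivative_mult_right, rule has_derivative_eq_rhs, rule has_derivative_ln[OF x(2) has_derivative_norm[OF x(1)]])
           (simp add: divide_inverse mult.commute)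
      then have "(moser_fun c \<rho> has_derivative (\<lambda>h. - c * (inverse (norm x) * (h \<bullet> sgn x)))) (at x)"
      proof (rule has_derivative_transform_within_open)
        show "open (ball (0::real^'n) 1 - cball 0 \<rho>)" by (intro open_Diff) auto
        show "x \<in> ball 0 1 - cball 0 \<rho>" using 2 by auto
        show "- c * ln (norm y) = moser_fun c \<rho> y" if "y \<in> ball 0 1 - cball 0 \<rho>" for y :: "real^'n"
          using that \<rho> by (simp add: moser_fun_def max_def min_def)
      qed
      moreover have "(\<lambda>h. - c * (inverse (norm x) * (h \<bullet> sgn x))) = (\<lambda>h. moser_grad c \<rho> x \<bullet> h)"
        using 2 by (auto simp: moser_grad_def sgn_div_norm inner_commute power2_eq_square field_simps)
      ultimately show ?thesis by simp
    qed
  qed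
qed

text \<open>The normalisation reads off the norm estimate: the weighted energy is at most c^2
  \<beta> 2Nm, from ln(1/\<rho>^(2N)) = 2Nm, and the function and its gradient contribute at most 2
  c^2 \<beta> each, whence 4.\<close>

lemma moser_fun_in_ball:
  fixes m :: real
  assumes N: "N \<ge> 2" and card: "CARD('n::finite) = 2 * N" and m: "m > 0"
  defines "c \<equiv> 1 / sqrt (unit_ball_vol (2 * real N) * (4 + 2 * real N * m))"
  shows "(moser_fun c (exp (- m)) :: real^'n \<Rightarrow> real) \<in> Hrad_ball N"
proof -
  define \<rho> where "\<rho> = exp (- m)"
  have \<rho>: "0 < \<rho>" "\<rho> < 1" using m by (auto simp: \<rho>_def)
  let ?\<beta> = "unit_ball_vol (2 * real N)"
  let ?u = "moser_fun c \<rho> :: real^'n \<Rightarrow> real"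
  let ?g = "moser_grad c \<rho> :: real^'n \<Rightarrow> real^'n"
  have \<beta>: "?\<beta> > 0" by simp
  have c2: "c\<^sup>2 = 1 / (?\<beta> * (4 + 2 * real N * m))"
    using \<beta> m by (simp add: c_def power_divide)
  define p where "p x = indicator {0<..1} (norm x ^ (2 * N)) * (1 / sqrt (norm x ^ (2 * N)))" for x :: "real^'n"
  define q where "q x = indicator {\<rho> ^ (2 * N)..1} (norm x ^ (2 * N)) * (1 / norm x ^ (2 * N))" for x :: "real^'n"
  have p: "integrable lebesgue p" "(\<integral>x. p x \<partial>lebesgue) = 2 * ?\<beta>"
    using integrable_inverse_sqrt_ball[where 'a = "real^'n"] by (simp_all add: p_def[abs_def] card)
  have \<rho>N: "0 < \<rho> ^ (2 * N)" "\<rho> ^ (2 * N) < 1"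
    using \<rho> N by (auto intro!: power_Suc_less_one power_strict_decreasing[of 0 "2 * N" \<rho>, simplified])
  have "ln (1 / \<rho> ^ (2 * N)) = 2 * real N * m"
    using \<rho> by (simp add: ln_div ln_realpow) (simp add: \<rho>_def)
  then have q: "integrable lebesgue q" "(\<integral>x. q x \<partial>lebesgue) = ?\<beta> * (2 * real N * m)"
    using integrable_inverse_shell[where 'a = "real^'n", OF \<rho>N] by (simp_all add: q_def[abs_def] card)
  have p_eq: "p x = 1 / norm x ^ N" if "0 < norm x" "norm x \<le> 1" for x
  proof -
    have "sqrt (norm x ^ (2 * N)) = norm x ^ N" by (simp add: power_even_eq)
    moreover have "0 < norm x ^ (2 * N)" "norm x ^ (2 * N) \<le> 1" using that by (auto intro: power_le_one)
    ultimately show ?thesis by (simp add: p_def)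
  qed
  have p0: "p x \<ge> 0" and q0: "q x \<ge> 0" for x by (auto simp: p_def q_def)
  \<comment> \<open>Here N >= 2 enters: inside the unit ball |x|^(-2) is at most |x|^(-N).\<close>
  have inv2: "1 / (norm x)\<^sup>2 \<le> p x" if "0 < norm x" "norm x \<le> 1" for x
  proof -
    have "norm x ^ N \<le> (norm x)\<^sup>2" using that N by (intro power_decreasing) auto
    then show ?thesis unfolding p_eq[OF that] using that by (intro divide_left_mono) auto
  qed
  have u_le: "(?u x)\<^sup>2 \<le> c\<^sup>2 * p x" if "x \<noteq> 0" for x
  proof (cases "norm x \<le> 1")
    case False
    then have "?u x = 0" using \<rho> by (simp add: moser_fun_def max_def min_def)
    then show ?thesis using p0 by simp
  next
    case True
    let ?t = "max \<rho> (min 1 (norm x))"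
    have t: "norm x \<le> ?t" "?t \<le> 1" "0 < ?t" using True \<rho> by auto
    have x0: "norm x > 0" using that by simp
    \<comment> \<open>The clamped radius is at least |x|, so ln y <= y - 1 at its reciprocal
      controls the logarithm by 1/|x|.\<close>
    have "\<bar>ln ?t\<bar> \<le> 1 / norm x"
    proof -
      have "- ln ?t = ln (1 / ?t)" using t by (simp add: ln_div)
      also have "\<dots> \<le> 1 / ?t" using t ln_le_minus_one[of "1 / ?t"] by simp
      also have "\<dots> \<le> 1 / norm x" using t x0 by (intro divide_left_mono) auto
      finally show ?thesis using t by simp
    qed
    then have "(ln ?t)\<^sup>2 \<le> (1 / norm x)\<^sup>2" using abs_le_square_iff[of "ln ?t" "1 / norm x"] by simp
    also have "\<dots> \<le> p x" using inv2[OF x0 True] by (simp add: power_divide)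
    finally show ?thesis unfolding moser_fun_def by (simp add: power_mult_distrib mult_left_mono)
  qed
  have norm_g: "norm (?g x) = (if \<rho> < norm x \<and> norm x < 1 then \<bar>c\<bar> / norm x else 0)" for x
    using \<rho> by (auto simp: moser_grad_def power2_eq_square)
  have g_le: "(norm (?g x))\<^sup>2 \<le> c\<^sup>2 * p x" for x
  proof (cases "\<rho> < norm x \<and> norm x < 1")
    case True
    then have "0 < norm x" "norm x \<le> 1" using \<rho> by linarith+
    from mult_left_mono[OF inv2[OF this], of "c\<^sup>2"] show ?thesis
      using True by (simp add: norm_g power_divide)
  qed (use p0 in \<open>auto simp: norm_g\<close>)
  have w_le: "(norm (?g x) / norm x ^ (N - 1))\<^sup>2 \<le> c\<^sup>2 * q x" for x
  proof (cases "\<rho> < norm x \<and> norm x < 1")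
    case True
    then have x: "norm x > 0" using \<rho> by linarith
    have "norm x * norm x ^ (N - 1) = norm x ^ N" using N by (simp flip: power_Suc)
    then have "(norm (?g x) / norm x ^ (N - 1))\<^sup>2 = (\<bar>c\<bar> / norm x ^ N)\<^sup>2"
      using True by (simp add: norm_g)
    also have "\<dots> = c\<^sup>2 / norm x ^ (2 * N)" by (simp add: power_divide power_mult mult.commute flip: power_mult)
    also have "\<dots> = c\<^sup>2 * q x"
      using True \<rho> by (auto simp: q_def power_mono power_le_one)
    finally show ?thesis by simp
  qed (use q0 in \<open>auto simp: norm_g\<close>)
  have meas_u: "?u \<in> borel_measurable borel" unfolding moser_fun_def by measurable
  have meas_g: "?g \<in> borel_measurable borel" unfolding moser_grad_def by measurable
  have meas: "?u \<in> borel_measurable lebesgue" "?g \<in> borel_measurable lebesgue"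
    using meas_u meas_g by (auto intro: measurable_completion)
  have meas2: "(\<lambda>x. (?u x)\<^sup>2) \<in> borel_measurable lebesgue" "(\<lambda>x. (norm (?g x))\<^sup>2) \<in> borel_measurable lebesgue"
    "(\<lambda>x. (norm (?g x) / norm x ^ (N - 1))\<^sup>2) \<in> borel_measurable lebesgue"
    using meas_u meas_g by (auto intro!: measurable_completion)
  \<comment> \<open>The pointwise bound fails at the origin, where \<open>p\<close> is 0 but the
    function is not.\<close>
  have AE_u: "AE x in lebesgue. (?u x)\<^sup>2 \<le> c\<^sup>2 * p x"
    by (rule AE_completion, rule eventually_mono[OF AE_lborel_singleton[of 0]]) (use u_le in auto)
  have cp: "integrable lebesgue (\<lambda>x. c\<^sup>2 * p x)" and cq: "integrable lebesgue (\<lambda>x. c\<^sup>2 * q x)"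
    using p q by auto
  have int: "integrable lebesgue (\<lambda>x. (?u x)\<^sup>2)" "integrable lebesgue (\<lambda>x. (norm (?g x))\<^sup>2)"
    "integrable lebesgue (\<lambda>x. (norm (?g x) / norm x ^ (N - 1))\<^sup>2)"
  proof -
    show "integrable lebesgue (\<lambda>x. (?u x)\<^sup>2)"
      by (rule Bochner_Integration.integrable_bound[OF cp meas2(1)])
         (use AE_u in \<open>auto elim!: eventually_mono intro: order_trans[OF _ abs_ge_self]\<close>)
    show "integrable lebesgue (\<lambda>x. (norm (?g x))\<^sup>2)"
      by (rule Bochner_Integration.integrable_bound[OF cp meas2(2)])
         (use g_le in \<open>auto intro: order_trans[OF _ abs_ge_self]\<close>)
    show "integrable lebesgue (\<lambda>x. (norm (?g x) / norm x ^ (N - 1))\<^sup>2)"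
      by (rule Bochner_Integration.integrable_bound[OF cq meas2(3)])
         (use w_le in \<open>auto intro: order_trans[OF _ abs_ge_self]\<close>)
  qed
  have "(\<integral>x. (?u x)\<^sup>2 \<partial>lebesgue) + (\<integral>x. (norm (?g x))\<^sup>2 \<partial>lebesgue)
          + (\<integral>x. (norm (?g x) / norm x ^ (N - 1))\<^sup>2 \<partial>lebesgue)
    \<le> (\<integral>x. c\<^sup>2 * p x \<partial>lebesgue) + (\<integral>x. c\<^sup>2 * p x \<partial>lebesgue) + (\<integral>x. c\<^sup>2 * q x \<partial>lebesgue)"
    using integral_mono_AE[OF int(1) cp AE_u] integral_mono[OF int(2) cp g_le] integral_mono[OF int(3) cq w_le]
    by linarith
  also have "\<dots> = c\<^sup>2 * (?\<beta> * (4 + 2 * real N * m))"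
    by (simp add: p q algebra_simps)
  also have "\<dots> = 1"
  proof -
    have "?\<beta> * (4 + 2 * real N * m) > 0" using \<beta> m by (intro mult_pos_pos add_pos_nonneg) auto
    moreover have "1 / X * X = 1" if "X > 0" for X :: real using that by simp
    ultimately show ?thesis unfolding c2 by blast
  qed
  finally have "?u \<in> Hrad_ball N"
    using meas int weak_grad_moser[OF \<rho>, of c, where 'n = 'n]
    unfolding Hrad_ball_def radial_def by (auto simp: moser_fun_def)
  then show ?thesis by (simp add: \<rho>_def)
qed

text \<open>Only the ball of radius exp(-m) is kept; there the Moser function is the constant c m,
  and the volume is \<beta> exp(-2Nm).\<close>

lemma MT_sup_ge:
  fixes m :: real
  assumes N: "N \<ge> 2" and card: "CARD('n::finite) = 2 * N" and m: "m > 0" and \<gamma>: "\<gamma> > 0"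
  defines "\<beta> \<equiv> unit_ball_vol (2 * real N)"
  shows "ennreal ((exp (\<gamma> * m\<^sup>2 / (\<beta> * (4 + 2 * real N * m))) - 1) * (\<beta> * exp (- (2 * real N * m))))
    \<le> MT_sup N \<gamma> TYPE('n)"
proof -
  have \<beta>0: "\<beta> > 0" by (simp add: \<beta>_def)
  define c where "c = 1 / sqrt (\<beta> * (4 + 2 * real N * m))"
  let ?u = "moser_fun c (exp (- m)) :: real^'n \<Rightarrow> real"
  let ?A = "exp (\<gamma> * m\<^sup>2 / (\<beta> * (4 + 2 * real N * m))) - 1"
  have u: "?u \<in> Hrad_ball N"
    unfolding c_def \<beta>_def by (rule moser_fun_in_ball[OF N card m])
  have c2: "c\<^sup>2 = 1 / (\<beta> * (4 + 2 * real N * m))"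
    using \<beta>0 m by (simp add: c_def power_divide)
  have "ennreal (?A * (\<beta> * exp (- (2 * real N * m)))) = ennreal ?A * emeasure lborel (cball (0::real^'n) (exp (- m)))"
  proof -
    have "0 \<le> ?A" using \<gamma> \<beta>0 m by simp
    moreover have "exp (- m) ^ (2 * N) = exp (- (2 * real N * m))"
      by (simp flip: exp_of_nat_mult)
    ultimately show ?thesis using \<beta>0 by (simp add: emeasure_cball card ennreal_mult \<beta>_def)
  qed
  also have "\<dots> = (\<integral>\<^sup>+ x. ennreal ?A * indicator (cball (0::real^'n) (exp (- m))) x \<partial>lborel)"
    by (rule nn_integral_cmult_indicator[symmetric]) simp
  also have "\<dots> \<le> (\<integral>\<^sup>+ x. ennreal (exp (\<gamma> * (?u x)\<^sup>2) - 1) \<partial>lborel)"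
  proof (rule nn_integral_mono)
    fix x :: "real^'n"
    show "ennreal ?A * indicator (cball 0 (exp (- m))) x \<le> ennreal (exp (\<gamma> * (?u x)\<^sup>2) - 1)"
    proof (cases "norm x \<le> exp (- m)")
      case True
      moreover have "exp (- m) < 1" using m by simp
      ultimately have "max (exp (- m)) (min 1 (norm x)) = exp (- m)" by simp
      then have "?u x = c * m" by (simp add: moser_fun_def)
      then have "\<gamma> * (?u x)\<^sup>2 = \<gamma> * m\<^sup>2 / (\<beta> * (4 + 2 * real N * m))"
        by (simp add: power_mult_distrib c2)
      then show ?thesis by (simp add: indicator_def)
    qed simp
  qed
  also have "\<dots> = (\<integral>\<^sup>+ x. ennreal (exp (\<gamma> * (?u x)\<^sup>2) - 1) \<partial>lebesgue)"
    by (simp add: nn_integral_completion)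
  also have "\<dots> \<le> MT_sup N \<gamma> TYPE('n)"
    unfolding MT_sup_def by (rule SUP_upper[OF u])
  finally show ?thesis .
qed

text \<open>For large m the exponent is about \<gamma> m / (2N \<beta>), to be compared with the
  volume decay 2Nm. They balance at \<gamma> = 4 N^2 \<beta>, and any excess \<delta> gives growth
  linear in m.\<close>

lemma MT_sup_infinite:
  assumes N: "N \<ge> 2" and card: "CARD('n::finite) = 2 * N" and \<gamma>: "\<gamma> > gammaN N"
  shows "MT_sup N \<gamma> TYPE('n) = \<infinity>"
proof (rule ccontr)
  assume "MT_sup N \<gamma> TYPE('n) \<noteq> \<infinity>"
  then obtain r where r: "r \<ge> 0" "MT_sup N \<gamma> TYPE('n) = ennreal r"
    by (cases "MT_sup N \<gamma> TYPE('n)") auto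
  define \<beta> where "\<beta> = unit_ball_vol (2 * real N)"
  define \<delta> where "\<delta> = \<gamma> - gammaN N"
  have \<beta>: "\<beta> > 0" by (simp add: \<beta>_def)
  have \<delta>: "\<delta> > 0" using \<gamma> by (simp add: \<delta>_def)
  have gN: "gammaN N = 4 * (real N)\<^sup>2 * \<beta>" using gammaN_unit_ball_vol[of N] N by (simp add: \<beta>_def)
  have \<gamma>0: "\<gamma> > 0" using \<gamma> \<beta> N unfolding gN by (smt (verit) mult_nonneg_nonneg zero_le_power2)
  \<comment> \<open>The second entry makes the lower-order loss 8N\<beta> at most half of \<delta>
    m; the third makes the linear growth exceed (r + \<beta> + 1)/\<beta>.\<close>
  define m where "m = max 1 (max (16 * real N * \<beta> / \<delta>) (8 * real N * (r + \<beta> + 1) / \<delta>))"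
  have m1: "m \<ge> 1" and "16 * real N * \<beta> / \<delta> \<le> m" "8 * real N * (r + \<beta> + 1) / \<delta> \<le> m"
    by (auto simp: m_def)
  then have m2: "\<delta> * m \<ge> 16 * real N * \<beta>" and m3: "\<delta> * m \<ge> 8 * real N * (r + \<beta> + 1)"
    using \<delta> by (auto simp: pos_divide_le_eq mult.commute)
  define X where "X = \<gamma> * m\<^sup>2 / (\<beta> * (4 + 2 * real N * m))"
  have den: "4 + 2 * real N * m \<le> 4 * real N * m"
  proof -
    have "2 * 1 \<le> real N * m" using N m1 by (intro mult_mono) auto
    then show ?thesis by (simp add: mult.commute)
  qed
  have den0: "4 + 2 * real N * m > 0" using m1 by (simp add: add_pos_nonneg)
  \<comment> \<open>The main terms cancel by the formula for \<gamma>_N, leaving m(\<delta> m -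
    8N\<beta>) over the denominator. Half of \<delta> m survives, and the denominator is at most
    4N\<beta> m.\<close>
  have "\<delta> * m / (8 * real N * \<beta>) \<le> X - 2 * real N * m"
  proof -
    have "X - 2 * real N * m = (\<gamma> * m\<^sup>2 - 2 * real N * m * (\<beta> * (4 + 2 * real N * m))) / (\<beta> * (4 + 2 * real N * m))"
      using \<beta> den0 by (simp add: X_def diff_divide_distrib)
    also have "\<gamma> * m\<^sup>2 - 2 * real N * m * (\<beta> * (4 + 2 * real N * m)) = m * (\<delta> * m - 8 * real N * \<beta>)"
      by (simp add: \<delta>_def gN power2_eq_square algebra_simps)
    finally have eq: "X - 2 * real N * m = m * (\<delta> * m - 8 * real N * \<beta>) / (\<beta> * (4 + 2 * real N * m))" .
    have half: "\<delta> * m / 2 \<le> \<delta> * m - 8 * real N * \<beta>" "8 * real N * \<beta> \<le> \<delta> * m"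
    proof -
      show "\<delta> * m / 2 \<le> \<delta> * m - 8 * real N * \<beta>" using m2 by simp
      moreover have "0 \<le> \<delta> * m" using \<delta> m1 by simp
      ultimately show "8 * real N * \<beta> \<le> \<delta> * m" by linarith
    qed
    have "\<delta> * m / (8 * real N * \<beta>) = m * (\<delta> * m / 2) / (\<beta> * (4 * real N * m))"
      using m1 N \<beta> by (simp add: field_simps)
    also have "\<dots> \<le> m * (\<delta> * m - 8 * real N * \<beta>) / (\<beta> * (4 + 2 * real N * m))"
      using m1 half den den0 \<beta> \<delta> by (intro frac_le mult_left_mono mult_nonneg_nonneg mult_pos_pos) auto
    finally show ?thesis unfolding eq .
  qed
  \<comment> \<open>The elementary bound 1 + y <= exp y is enough, since y already grows without
    bound in m.\<close>
  then have "1 + \<delta> * m / (8 * real N * \<beta>) \<le> exp (X - 2 * real N * m)"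
    using exp_ge_add_one_self[of "X - 2 * real N * m"] by linarith
  moreover have "(r + \<beta> + 1) / \<beta> \<le> \<delta> * m / (8 * real N * \<beta>)"
  proof -
    have "(r + \<beta> + 1) / \<beta> = 8 * real N * (r + \<beta> + 1) / (8 * real N * \<beta>)" using N by simp
    also have "\<dots> \<le> \<delta> * m / (8 * real N * \<beta>)" using m3 \<beta> by (intro divide_right_mono) auto
    finally show ?thesis .
  qed
  ultimately have "(r + \<beta> + 1) / \<beta> \<le> exp (X - 2 * real N * m)" by linarith
  then have big: "r + \<beta> + 1 \<le> \<beta> * exp (X - 2 * real N * m)" using \<beta> by (simp add: field_simps)
  have "(exp X - 1) * (\<beta> * exp (- (2 * real N * m))) = \<beta> * exp (X - 2 * real N * m) - \<beta> * exp (- (2 * real N * m))"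
    by (simp add: exp_diff exp_minus field_simps)
  moreover have "\<beta> * exp (- (2 * real N * m)) \<le> \<beta> * 1" using \<beta> m1 by (intro mult_left_mono) auto
  ultimately have "r < (exp X - 1) * (\<beta> * exp (- (2 * real N * m)))" using big by linarith
  then have "ennreal r < ennreal ((exp X - 1) * (\<beta> * exp (- (2 * real N * m))))"
    using r by (simp add: ennreal_less_iff)
  also have "\<dots> \<le> MT_sup N \<gamma> TYPE('n)"
    unfolding X_def \<beta>_def by (rule MT_sup_ge[OF N card _ \<gamma>0]) (use m1 in simp)
  finally show False using r by simp
qed

theorem theorem1p6:
  fixes N :: nat
  assumes "N \<ge> 2" and "CARD('n::finite) = 2 * N"
  shows "0 < MT_sup N (gammaN N) TYPE('n) \<and> MT_sup N (gammaN N) TYPE('n) < \<infinity>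
         \<and> (\<forall>\<gamma>>gammaN N. MT_sup N \<gamma> TYPE('n) = \<infinity>)"
proof (intro conjI allI impI)
  let ?\<beta> = "unit_ball_vol (2 * real N)"
  have \<gamma>: "gammaN N > 0"
    using gammaN_unit_ball_vol[of N] assms(1) by simp
  \<comment> \<open>Positivity needs a single competitor: the Moser function with m = 1.\<close>
  have "exp (gammaN N * 1\<^sup>2 / (?\<beta> * (4 + 2 * real N * 1))) > 1"
    using \<gamma> by (simp add: add_pos_nonneg)
  then have "0 < (exp (gammaN N * 1\<^sup>2 / (?\<beta> * (4 + 2 * real N * 1))) - 1) * (?\<beta> * exp (- (2 * real N * 1)))"
    by (intro mult_pos_pos) auto
  then have "0 < ennreal ((exp (gammaN N * 1\<^sup>2 / (?\<beta> * (4 + 2 * real N * 1))) - 1) * (?\<beta> * exp (- (2 * real N * 1))))"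
    by simp
  also have "\<dots> \<le> MT_sup N (gammaN N) TYPE('n)"
    by (rule MT_sup_ge[OF assms zero_less_one \<gamma>])
  finally show "0 < MT_sup N (gammaN N) TYPE('n)" .
  show "MT_sup N (gammaN N) TYPE('n) < \<infinity>"
    using assms by (intro MT_sup_finite) auto
  show "MT_sup N \<gamma> TYPE('n) = \<infinity>" if "\<gamma> > gammaN N" for \<gamma>
    using MT_sup_infinite[OF assms that] .
qed

end
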